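(* Let $H, G$ be discrete groups. Then $H\wr G$ is MAP if and only if either $H$ is MAP and $G$ is finite, or $H$ is trivial and $G$ is MAP, or $H$ is abelian and $G$ is RF.
   Context: A discrete group is MAP (maximally almost periodic) if its finite-dimensional unitary representations separate its points; it is RF (residually finite) if its homomorphisms to finite groups separate its points. $H\wr G$ is the regular (restricted) wreath product $\left(\bigoplus_{g\in G}H\right)\rtimes G$, where $G$ acts on the direct sum (finitely supported families) by $g_0\,(h_g)_{g\in G}=(h_{g_0^{-1}g})_{g\in G}$. *)

theory Defs
  imports "HOL-Algebra.Product_Groups" "HOL-Algebra.Elementary_Groups"
    "Jordan_Normal_Form.Schur_Decomposition"
begin

section \<open>Finite-dimensional unitary representations, MAP and RF groups\<close>

definition unitary_group :: "nat \<Rightarrow> complex mat monoid"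
  where "unitary_group n =
    \<lparr>carrier = {U \<in> carrier_mat n n. U * mat_adjoint U = 1\<^sub>m n \<and> mat_adjoint U * U = 1\<^sub>m n},
     monoid.mult = (*), one = 1\<^sub>m n\<rparr>"

lemma mat_adjoint_index:
  "\<lbrakk>i < dim_col A; j < dim_row A\<rbrakk> \<Longrightarrow> mat_adjoint A $$ (i, j) = conjugate (A $$ (j, i))"
  by (simp add: mat_adjoint_def mat_of_rows_index)

lemma mat_adjoint_carrier: "A \<in> carrier_mat n m \<Longrightarrow> mat_adjoint A \<in> carrier_mat m n"
  by (auto simp: mat_adjoint_def)

lemma mat_adjoint_adjoint: "mat_adjoint (mat_adjoint A) = A"
  by (rule eq_matI) (auto simp: mat_adjoint_index mat_adjoint_def mat_of_rows_index)

lemma mat_adjoint_one: "mat_adjoint (1\<^sub>m n :: complex mat) = 1\<^sub>m n"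
  using mat_adjoint_carrier[of "1\<^sub>m n :: complex mat" n n]
  by (intro eq_matI) (auto simp: mat_adjoint_index)

lemma mat_adjoint_times:
  fixes A B :: "complex mat"
  assumes A: "A \<in> carrier_mat n m" and B: "B \<in> carrier_mat m k"
  shows "mat_adjoint (A * B) = mat_adjoint B * mat_adjoint A"
proof (rule eq_matI)
  note car = mat_adjoint_carrier[OF A] mat_adjoint_carrier[OF B]
    mat_adjoint_carrier[OF mult_carrier_mat[OF A B]]
  show "dim_row (mat_adjoint (A * B)) = dim_row (mat_adjoint B * mat_adjoint A)"
    "dim_col (mat_adjoint (A * B)) = dim_col (mat_adjoint B * mat_adjoint A)"
    using car by auto
  fix i j assume "i < dim_row (mat_adjoint B * mat_adjoint A)"
    "j < dim_col (mat_adjoint B * mat_adjoint A)"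
  then have ij: "i < k" "j < n" using car by auto
  then show "mat_adjoint (A * B) $$ (i, j) = (mat_adjoint B * mat_adjoint A) $$ (i, j)"
    using A B car by (auto simp: mat_adjoint_index scalar_prod_def ac_simps intro!: sum.cong)
qed

lemma group_unitary_group: "group (unitary_group n)"
proof (rule groupI)
  fix U V assume "U \<in> carrier (unitary_group n)" "V \<in> carrier (unitary_group n)"
  then have U: "U \<in> carrier_mat n n" "U * mat_adjoint U = 1\<^sub>m n" "mat_adjoint U * U = 1\<^sub>m n"
    and V: "V \<in> carrier_mat n n" "V * mat_adjoint V = 1\<^sub>m n" "mat_adjoint V * V = 1\<^sub>m n"
    by (auto simp: unitary_group_def)
  note car = U(1) V(1) mat_adjoint_carrier[OF U(1)] mat_adjoint_carrier[OF V(1)]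
  have "U * V * (mat_adjoint V * mat_adjoint U) = U * (V * mat_adjoint V) * mat_adjoint U"
    using car by (simp add: assoc_mult_mat[of _ n n _ n _ n])
  moreover have "mat_adjoint V * mat_adjoint U * (U * V) = mat_adjoint V * (mat_adjoint U * U) * V"
    using car by (simp add: assoc_mult_mat[of _ n n _ n _ n])
  ultimately show "U \<otimes>\<^bsub>unitary_group n\<^esub> V \<in> carrier (unitary_group n)"
    using U V car by (simp add: unitary_group_def mat_adjoint_times[OF U(1) V(1)])
next
  fix U assume "U \<in> carrier (unitary_group n)"
  then show "\<exists>V\<in>carrier (unitary_group n). V \<otimes>\<^bsub>unitary_group n\<^esub> U = \<one>\<^bsub>unitary_group n\<^esub>"
    by (intro bexI[of _ "mat_adjoint U"])
      (auto simp: unitary_group_def mat_adjoint_adjoint mat_adjoint_carrier)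
qed (auto simp: unitary_group_def mat_adjoint_one assoc_mult_mat[of _ n n _ n _ n])

definition maximally_almost_periodic :: "('a, 'm) monoid_scheme \<Rightarrow> bool"
  where "maximally_almost_periodic G \<longleftrightarrow>
    (\<forall>x \<in> carrier G. \<forall>y \<in> carrier G. x \<noteq> y \<longrightarrow>
      (\<exists>n. \<exists>\<rho> \<in> hom G (unitary_group n). \<rho> x \<noteq> \<rho> y))"

text \<open>Finite groups are represented with carriers in \<^typ>\<open>nat\<close>, because a definition cannot
  quantify over types. This loses no generality: see \<open>residually_finiteI\<close>.\<close>

definition residually_finite :: "('a, 'm) monoid_scheme \<Rightarrow> bool"
  where "residually_finite G \<longleftrightarrow>
    (\<forall>x \<in> carrier G. \<forall>y \<in> carrier G. x \<noteq> y \<longrightarrow>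
      (\<exists>(F :: nat monoid). group F \<and> finite (carrier F) \<and> (\<exists>\<phi> \<in> hom G F. \<phi> x \<noteq> \<phi> y)))"

lemma finite_group_nat_copy:
  fixes K :: "('b, 'k) monoid_scheme"
  assumes K: "group K" and fin: "finite (carrier K)"
  shows "\<exists>(F :: nat monoid) f. group F \<and> finite (carrier F) \<and> f \<in> iso K F"
proof -
  interpret group K by (rule K)
  obtain f :: "'b \<Rightarrow> nat" where inj: "inj_on f (carrier K)"
    using finite_imp_inj_to_nat_seg[OF fin] by blast
  define g where "g = inv_into (carrier K) f"
  define F :: "nat monoid" where
    "F = \<lparr>carrier = f ` carrier K, monoid.mult = (\<lambda>a b. f (g a \<otimes>\<^bsub>K\<^esub> g b)), one = f \<one>\<^bsub>K\<^esub>\<rparr>"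
  have g: "g (f x) = x" if "x \<in> carrier K" for x
    using inj that by (simp add: g_def)
  have "f \<in> hom K F" by (auto simp: hom_def F_def g)
  moreover have "bij_betw f (carrier K) (carrier F)"
    using inj by (simp add: F_def bij_betw_def)
  ultimately have iso: "f \<in> iso K F" by (simp add: iso_def)
  have "group F"
  proof (rule groupI)
    fix x assume "x \<in> carrier F"
    then obtain a where a: "a \<in> carrier K" "x = f a" by (auto simp: F_def)
    then show "\<exists>y\<in>carrier F. y \<otimes>\<^bsub>F\<^esub> x = \<one>\<^bsub>F\<^esub>"
      by (intro bexI[of _ "f (inv\<^bsub>K\<^esub> a)"]) (auto simp: F_def g)
  qed (auto simp: F_def g m_assoc)
  with iso fin show ?thesis by (intro exI[of _ F] exI[of _ f]) (auto simp: F_def)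
qed

lemma residually_finiteI:
  fixes K :: "'a \<Rightarrow> 'a \<Rightarrow> ('b, 'k) monoid_scheme"
  assumes "\<And>x y. \<lbrakk>x \<in> carrier G; y \<in> carrier G; x \<noteq> y\<rbrakk> \<Longrightarrow>
    group (K x y) \<and> finite (carrier (K x y)) \<and> (\<exists>\<phi> \<in> hom G (K x y). \<phi> x \<noteq> \<phi> y)"
  shows "residually_finite G"
  unfolding residually_finite_def
proof (intro ballI impI)
  fix x y assume xy: "x \<in> carrier G" "y \<in> carrier G" "x \<noteq> y"
  then obtain \<phi> where K: "group (K x y)" "finite (carrier (K x y))"
    and \<phi>: "\<phi> \<in> hom G (K x y)" "\<phi> x \<noteq> \<phi> y" using assms by blast
  obtain F :: "nat monoid" and f where F: "group F" "finite (carrier F)" "f \<in> iso (K x y) F"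
    using finite_group_nat_copy[OF K] by blast
  have "f \<circ> \<phi> \<in> hom G F"
    using F(3) \<phi>(1) hom_compose[of \<phi> G "K x y" f F] by (auto simp: iso_def)
  moreover have "(f \<circ> \<phi>) x \<noteq> (f \<circ> \<phi>) y"
    using F(3) \<phi> xy by (auto simp: iso_def bij_betw_def inj_on_def hom_def Pi_iff)
  ultimately show "\<exists>(F :: nat monoid). group F \<and> finite (carrier F) \<and>
      (\<exists>\<phi> \<in> hom G F. \<phi> x \<noteq> \<phi> y)" using F by blast
qed

section \<open>Restricted regular wreath products\<close>

definition semidirect_product ::
  "('n, 'm) monoid_scheme \<Rightarrow> ('g, 'k) monoid_scheme \<Rightarrow> ('g \<Rightarrow> 'n \<Rightarrow> 'n) \<Rightarrow> ('n \<times> 'g) monoid"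
  where "semidirect_product N G \<alpha> =
    \<lparr>carrier = carrier N \<times> carrier G,
     monoid.mult = (\<lambda>(a, g) (b, h). (a \<otimes>\<^bsub>N\<^esub> \<alpha> g b, g \<otimes>\<^bsub>G\<^esub> h)),
     one = (\<one>\<^bsub>N\<^esub>, \<one>\<^bsub>G\<^esub>)\<rparr>"

definition shift_action :: "('g, 'k) monoid_scheme \<Rightarrow> 'g \<Rightarrow> ('g \<Rightarrow> 'h) \<Rightarrow> 'g \<Rightarrow> 'h"
  where "shift_action G g\<^sub>0 f = (\<lambda>g \<in> carrier G. f (inv\<^bsub>G\<^esub> g\<^sub>0 \<otimes>\<^bsub>G\<^esub> g))"

definition wreath_product ::
  "('h, 'm) monoid_scheme \<Rightarrow> ('g, 'k) monoid_scheme \<Rightarrow> (('g \<Rightarrow> 'h) \<times> 'g) monoid"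
  where "wreath_product H G =
    semidirect_product (sum_group (carrier G) (\<lambda>_. H)) G (shift_action G)"

lemma group_semidirect_product:
  assumes N: "group N" and G: "group G"
    and closed: "\<And>g a. \<lbrakk>g \<in> carrier G; a \<in> carrier N\<rbrakk> \<Longrightarrow> \<alpha> g a \<in> carrier N"
    and mult: "\<And>g a b. \<lbrakk>g \<in> carrier G; a \<in> carrier N; b \<in> carrier N\<rbrakk> \<Longrightarrow>
      \<alpha> g (a \<otimes>\<^bsub>N\<^esub> b) = \<alpha> g a \<otimes>\<^bsub>N\<^esub> \<alpha> g b"
    and one: "\<And>a. a \<in> carrier N \<Longrightarrow> \<alpha> \<one>\<^bsub>G\<^esub> a = a"
    and comp: "\<And>g h a. \<lbrakk>g \<in> carrier G; h \<in> carrier G; a \<in> carrier N\<rbrakk> \<Longrightarrow>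
      \<alpha> (g \<otimes>\<^bsub>G\<^esub> h) a = \<alpha> g (\<alpha> h a)"
  shows "group (semidirect_product N G \<alpha>)"
proof -
  interpret N: group N by (rule N)
  interpret G: group G by (rule G)
  show ?thesis
  proof (rule groupI)
    fix x assume "x \<in> carrier (semidirect_product N G \<alpha>)"
    then obtain a g where x: "x = (a, g)" "a \<in> carrier N" "g \<in> carrier G"
      by (auto simp: semidirect_product_def)
    then show "\<exists>y\<in>carrier (semidirect_product N G \<alpha>).
        y \<otimes>\<^bsub>semidirect_product N G \<alpha>\<^esub> x = \<one>\<^bsub>semidirect_product N G \<alpha>\<^esub>"
      by (intro bexI[of _ "(inv\<^bsub>N\<^esub> (\<alpha> (inv\<^bsub>G\<^esub> g) a), inv\<^bsub>G\<^esub> g)"])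
        (auto simp: semidirect_product_def closed)
  qed (auto simp: semidirect_product_def closed mult one comp N.m_assoc G.m_assoc)
qed

lemma group_wreath_product:
  assumes H: "group H" and G: "group G"
  shows "group (wreath_product H G)"
proof -
  interpret H: group H by (rule H)
  interpret G: group G by (rule G)
  have fin: "finite {k \<in> carrier G. f (inv\<^bsub>G\<^esub> g \<otimes>\<^bsub>G\<^esub> k) \<noteq> \<one>\<^bsub>H\<^esub>}"
    if g: "g \<in> carrier G" and f: "finite {k \<in> carrier G. f k \<noteq> \<one>\<^bsub>H\<^esub>}" for f g
  proof (rule finite_subset)
    show "{k \<in> carrier G. f (inv\<^bsub>G\<^esub> g \<otimes>\<^bsub>G\<^esub> k) \<noteq> \<one>\<^bsub>H\<^esub>}
        \<subseteq> (\<lambda>k. g \<otimes>\<^bsub>G\<^esub> k) ` {k \<in> carrier G. f k \<noteq> \<one>\<^bsub>H\<^esub>}"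
    proof
      fix k assume k: "k \<in> {k \<in> carrier G. f (inv\<^bsub>G\<^esub> g \<otimes>\<^bsub>G\<^esub> k) \<noteq> \<one>\<^bsub>H\<^esub>}"
      then have "k = g \<otimes>\<^bsub>G\<^esub> (inv\<^bsub>G\<^esub> g \<otimes>\<^bsub>G\<^esub> k)" using g by (simp add: G.m_assoc[symmetric])
      then show "k \<in> (\<lambda>k. g \<otimes>\<^bsub>G\<^esub> k) ` {k \<in> carrier G. f k \<noteq> \<one>\<^bsub>H\<^esub>}"
        using k g by (intro image_eqI) auto
    qed
    show "finite ((\<lambda>k. g \<otimes>\<^bsub>G\<^esub> k) ` {k \<in> carrier G. f k \<noteq> \<one>\<^bsub>H\<^esub>})"
      using f by (rule finite_imageI)
  qed
  show ?thesis
    unfolding wreath_product_def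
  proof (rule group_semidirect_product)
    fix g a assume "g \<in> carrier G" "a \<in> carrier (sum_group (carrier G) (\<lambda>_. H))"
    then show "shift_action G g a \<in> carrier (sum_group (carrier G) (\<lambda>_. H))"
      using fin by (auto simp: carrier_sum_group H shift_action_def PiE_iff cong: conj_cong)
  qed (auto simp: H G carrier_sum_group shift_action_def PiE_iff extensional_def fun_eq_iff
        restrict_def G.inv_mult_group G.m_assoc)
qed

end

theory Submission
  imports Defs "HOL-Algebra.Bij"
begin

text \<open>
  Necessity rests on a finiteness property of unitary representations \<open>\<rho>\<close> of \<open>W = H \<wr> G\<close>. Fix
  \<open>h\<close> in \<open>H\<close> and let \<open>D h g\<close> be the image under \<open>\<rho>\<close> of the family with entry \<open>h\<close> at the coordinate \<open>g\<close>.
  The matrices \<open>D h g\<close> commute with each other, and they are conjugate, so they have the same finitely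
  many eigenvalues. Commuting unitary matrices are determined by their eigenvalues on common
  eigenvectors, so distinct ones among the \<open>D h g\<close> are at least a fixed distance apart. Since unitary
  matrices form a bounded set, there are only finitely many of them (\<open>commuting_unitaries_finite\<close>,
  \<open>finite_coordinate_orbit\<close>).

  Two consequences follow. If \<open>G\<close> is infinite, then \<open>D h g = D h g'\<close> for some \<open>g \<noteq> g'\<close>. The matrix
  \<open>D h g'\<close> commutes with \<open>D k g\<close> for every \<open>k\<close> in \<open>H\<close>, so the commutator of \<open>h\<close> and \<open>k\<close> placed at one
  coordinate is in the kernel of every \<open>\<rho>\<close>, and \<open>H\<close> is abelian if \<open>W\<close> is MAP
  (\<open>comm_group_if_infinite_top\<close>). Moreover \<open>G\<close> acts by conjugation on the finite set of all
  \<open>D h g\<close>. If \<open>h \<noteq> \<one>\<close> and \<open>W\<close> is MAP, these actions separate the points of \<open>G\<close>, so \<open>G\<close> is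
  residually finite (\<open>residually_finite_if_nontrivial_base\<close>). In the remaining cases it is enough that
  \<open>H\<close> and \<open>G\<close> embed into \<open>W\<close>.

  Sufficiency uses induced representations (\<open>induced_representation\<close>). From a homomorphism \<open>\<phi>\<close> of \<open>G\<close> to a
  finite group \<open>F\<close> and an equivariant family \<open>\<tau>\<close> of representations of the base indexed by \<open>F\<close>, they
  produce block permutation matrices that detect both \<open>\<phi>\<close> and \<open>\<tau>\<close>. If \<open>G\<close> is finite, take
  \<open>F = G\<close> and evaluate representations of \<open>H\<close> at the coordinates. If \<open>H\<close> is abelian and \<open>G\<close> is
  residually finite, take finite quotients \<open>F\<close> and multiply a character of \<open>H\<close> over the fibres of \<open>\<phi>\<close>.
  That characters of an abelian group separate its points is proved by extending
  partial characters with Zorn's lemma (\<open>characters_separate_points\<close>). If \<open>H\<close> is trivial, then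
  \<open>W\<close> is isomorphic to \<open>G\<close>.
\<close>

section \<open>Unitary matrices\<close>

lemma unitary_groupD:
  assumes "U \<in> carrier (unitary_group n)"
  shows "U \<in> carrier_mat n n" "U * mat_adjoint U = 1\<^sub>m n" "mat_adjoint U * U = 1\<^sub>m n"
  using assms by (auto simp: unitary_group_def)

lemma mult_unitary_group [simp]: "U \<otimes>\<^bsub>unitary_group n\<^esub> V = U * V"
  by (simp add: unitary_group_def)

lemma one_unitary_group [simp]: "\<one>\<^bsub>unitary_group n\<^esub> = 1\<^sub>m n"
  by (simp add: unitary_group_def)

text \<open>A square matrix with a right inverse has it as a left inverse too, so orthonormality of the rows
  is enough.\<close>

lemma unitary_groupI:
  fixes U :: "complex mat"
  assumes U: "U \<in> carrier_mat n n"
    and rows: "\<And>i j. \<lbrakk>i < n; j < n\<rbrakk> \<Longrightarrow> (\<Sum>k<n. U $$ (i, k) * cnj (U $$ (j, k))) = (if i = j then 1 else 0)"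
  shows "U \<in> carrier (unitary_group n)"
proof -
  have adj: "mat_adjoint U \<in> carrier_mat n n" by (rule mat_adjoint_carrier[OF U])
  have "U * mat_adjoint U = 1\<^sub>m n"
  proof (rule eq_matI)
    fix i j assume "i < dim_row (1\<^sub>m n :: complex mat)" "j < dim_col (1\<^sub>m n :: complex mat)"
    then have ij: "i < n" "j < n" by auto
    then show "(U * mat_adjoint U) $$ (i, j) = 1\<^sub>m n $$ (i, j)"
      using U adj rows[OF ij]
      by (simp add: scalar_prod_def mat_adjoint_index atLeast0LessThan)
  qed (use U adj in auto)
  moreover from mat_mult_left_right_inverse[OF U adj this] have "mat_adjoint U * U = 1\<^sub>m n" .
  ultimately show ?thesis using U by (simp add: unitary_group_def)
qed

lemma unitary_row_orthonormal:
  assumes "U \<in> carrier (unitary_group n)" and ij: "i < n" "j < n"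
  shows "(\<Sum>k<n. U $$ (i, k) * cnj (U $$ (j, k))) = (if i = j then 1 else 0)"
proof -
  note U = unitary_groupD[OF assms(1)]
  have "(U * mat_adjoint U) $$ (i, j) = (\<Sum>k<n. U $$ (i, k) * cnj (U $$ (j, k)))"
    using ij U(1) mat_adjoint_carrier[OF U(1)]
    by (simp add: scalar_prod_def mat_adjoint_index atLeast0LessThan)
  with U(2) ij show ?thesis by simp
qed

lemma unitary_row_norm:
  assumes "U \<in> carrier (unitary_group n)" and i: "i < n"
  shows "(\<Sum>k<n. (cmod (U $$ (i, k)))\<^sup>2) = 1"
proof -
  have "complex_of_real (\<Sum>k<n. (cmod (U $$ (i, k)))\<^sup>2) = (\<Sum>k<n. U $$ (i, k) * cnj (U $$ (i, k)))"
    by (simp add: complex_norm_square[symmetric])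
  also have "\<dots> = 1" using unitary_row_orthonormal[OF assms i] by simp
  finally show ?thesis using of_real_eq_1_iff by blast
qed

lemma unitary_entry_le_1:
  assumes "U \<in> carrier (unitary_group n)" and i: "i < n" and j: "j < n"
  shows "cmod (U $$ (i, j)) \<le> 1"
proof -
  have "(cmod (U $$ (i, j)))\<^sup>2 \<le> (\<Sum>k<n. (cmod (U $$ (i, k)))\<^sup>2)"
    using j by (intro member_le_sum) auto
  then have "(cmod (U $$ (i, j)))\<^sup>2 \<le> 1\<^sup>2" using unitary_row_norm[OF assms(1) i] by simp
  then show ?thesis by (rule power2_le_imp_le) simp
qed

section \<open>Commuting unitary matrices with finitely many eigenvalues\<close>

lemma trace_mult_commute:
  fixes A B :: "complex mat"
  assumes "A \<in> carrier_mat n n" "B \<in> carrier_mat n n"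
  shows "(\<Sum>i<n. (A * B) $$ (i, i)) = (\<Sum>i<n. (B * A) $$ (i, i))"
proof -
  have "(\<Sum>i<n. (A * B) $$ (i, i)) = (\<Sum>i<n. \<Sum>k<n. A $$ (i, k) * B $$ (k, i))"
    using assms by (intro sum.cong) (auto simp: scalar_prod_def atLeast0LessThan)
  also have "\<dots> = (\<Sum>k<n. \<Sum>i<n. B $$ (k, i) * A $$ (i, k))"
    by (subst sum.swap) (simp add: mult.commute)
  also have "\<dots> = (\<Sum>i<n. (B * A) $$ (i, i))"
    using assms by (intro sum.cong) (auto simp: scalar_prod_def atLeast0LessThan)
  finally show ?thesis .
qed

lemma schur_triangularization:
  fixes A :: "complex mat"
  assumes A: "A \<in> carrier_mat n n"
  obtains B P Q where "similar_mat_wit A B P Q" "upper_triangular B"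
    "\<And>i. i < n \<Longrightarrow> eigenvalue A (B $$ (i, i))"
proof -
  obtain es where es: "char_poly A = (\<Prod>a\<leftarrow>es. [:- a, 1:])" "length es = n"
    using char_poly_factorized[OF A] by blast
  obtain B P Q where "schur_decomposition A es = (B, P, Q)"
    by (cases "schur_decomposition A es")
  from schur_decomposition[OF A es(1) this]
  have B: "similar_mat_wit A B P Q" "upper_triangular B" "diag_mat B = es" by auto
  have "eigenvalue A (B $$ (i, i))" if i: "i < n" for i
  proof -
    have "B $$ (i, i) = es ! i" using B(3) i es(2) by (auto simp: diag_mat_def)
    then have "B $$ (i, i) \<in> set es" using i es(2) by auto
    then have "poly (char_poly A) (B $$ (i, i)) = 0"
      unfolding es(1) poly_prod_list by (auto simp: prod_list_zero_iff)
    then show ?thesis using eigenvalue_root_char_poly[OF A] by simp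
  qed
  with B that show thesis by blast
qed

text \<open>By triangularization the trace is the sum of \<open>n\<close> eigenvalues, hence equal to \<open>n\<close>. The
  diagonal entries of a unitary matrix have modulus at most \<open>1\<close>, so all of them are \<open>1\<close>; since
  every row has norm \<open>1\<close>, nothing is left for the other entries.\<close>

lemma unitary_with_all_eigenvalues_one:
  assumes U: "U \<in> carrier (unitary_group n)" and ev: "\<And>\<nu>. eigenvalue U \<nu> \<Longrightarrow> \<nu> = 1"
  shows "U = 1\<^sub>m n"
proof -
  note UC = unitary_groupD(1)[OF U]
  obtain B P Q where sim: "similar_mat_wit U B P Q"
    and diag: "\<And>i. i < n \<Longrightarrow> eigenvalue U (B $$ (i, i))"
    using schur_triangularization[OF UC] by metis
  note s = similar_mat_witD2[OF UC sim]
  have "(\<Sum>i<n. U $$ (i, i)) = (\<Sum>i<n. (P * (B * Q)) $$ (i, i))"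
    using s by (simp add: assoc_mult_mat[of _ n n _ n _ n])
  also have "\<dots> = (\<Sum>i<n. (B * Q * P) $$ (i, i))"
    using s by (intro trace_mult_commute) auto
  also have "B * Q * P = B" using s by (simp add: assoc_mult_mat[of _ n n _ n _ n])
  also have "(\<Sum>i<n. B $$ (i, i)) = of_nat n" using ev[OF diag] by simp
  finally have "Re (\<Sum>i<n. U $$ (i, i)) = real n" by simp
  then have "(\<Sum>i<n. 1 - Re (U $$ (i, i))) = 0" by (simp add: sum_subtractf)
  moreover have le: "0 \<le> 1 - Re (U $$ (i, i))" if "i < n" for i
    using unitary_entry_le_1[OF U that that] complex_Re_le_cmod[of "U $$ (i, i)"] by linarith
  ultimately have "\<forall>i\<in>{..<n}. 1 - Re (U $$ (i, i)) = 0"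
    by (subst (asm) sum_nonneg_eq_0_iff) auto
  then have re: "Re (U $$ (i, i)) = 1" if "i < n" for i using that by auto
  have c1: "cmod (U $$ (i, i)) = 1" if "i < n" for i
    using unitary_entry_le_1[OF U that that] complex_Re_le_cmod[of "U $$ (i, i)"] re[OF that] by linarith
  have diag1: "U $$ (i, i) = 1" if "i < n" for i
    using c1[OF that] re[OF that] by (auto simp: complex_eq_iff cmod_def)
  have off: "U $$ (i, j) = 0" if ij: "i < n" "j < n" "i \<noteq> j" for i j
  proof -
    have "(cmod (U $$ (i, i)))\<^sup>2 + (cmod (U $$ (i, j)))\<^sup>2 = (\<Sum>k\<in>{i, j}. (cmod (U $$ (i, k)))\<^sup>2)"
      using ij by simp
    also have "\<dots> \<le> (\<Sum>k<n. (cmod (U $$ (i, k)))\<^sup>2)"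
      using ij by (intro sum_mono2) auto
    also have "\<dots> = 1" by (rule unitary_row_norm[OF U ij(1)])
    finally show ?thesis using c1[OF ij(1)] by simp
  qed
  show ?thesis using UC diag1 off by (intro eq_matI) auto
qed

text \<open>The \<open>\<nu>\<close>-eigenspace of \<open>X\<close> is invariant under \<open>A\<close>, and \<open>A\<close> should have an eigenvector in it.
  Work in coordinates in which \<open>A\<close> becomes an upper triangular \<open>B\<close>, and choose in the eigenspace
  a nonzero \<open>v\<close> whose last nonzero coordinate \<open>k\<close> is as small as possible. Then
  \<open>B v - B\<^sub>k\<^sub>k v\<close> lies in the eigenspace and has no nonzero coordinate from \<open>k\<close> on, so it
  vanishes by minimality.\<close>

lemma common_eigenvector:
  fixes A X :: "complex mat"
  assumes A: "A \<in> carrier_mat n n" and X: "X \<in> carrier_mat n n" and comm: "A * X = X * A"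
    and u: "eigenvector X u \<nu>"
  obtains w \<alpha> where "eigenvector A w \<alpha>" "eigenvector X w \<nu>"
proof -
  obtain B P Q where sim: "similar_mat_wit A B P Q" and ut: "upper_triangular B"
    using schur_triangularization[OF A] by metis
  note s = similar_mat_witD2[OF A sim]
  \<comment> \<open>\<open>E m v\<close>: the nonzero vector \<open>P v\<close> is in the eigenspace of \<open>X\<close>, and \<open>v\<close> vanishes from coordinate \<open>m\<close> on.\<close>
  define E where "E m v \<longleftrightarrow> v \<in> carrier_vec n \<and> v \<noteq> 0\<^sub>v n \<and> X *\<^sub>v (P *\<^sub>v v) = \<nu> \<cdot>\<^sub>v (P *\<^sub>v v)
    \<and> (\<forall>i. m \<le> i \<longrightarrow> i < n \<longrightarrow> v $ i = 0)" for m v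
  have PQ: "P *\<^sub>v (Q *\<^sub>v v) = v" if "v \<in> carrier_vec n" for v
    using that s by (simp flip: assoc_mult_mat_vec[of _ n n _ n])
  have QP: "Q *\<^sub>v (P *\<^sub>v v) = v" if "v \<in> carrier_vec n" for v
    using that s by (simp flip: assoc_mult_mat_vec[of _ n n _ n])
  have AP: "A *\<^sub>v (P *\<^sub>v v) = P *\<^sub>v (B *\<^sub>v v)" if v: "v \<in> carrier_vec n" for v
    using v s QP[OF v] by (simp add: assoc_mult_mat_vec[of _ n n _ n])
  have P0: "P *\<^sub>v v \<noteq> 0\<^sub>v n" if v: "v \<in> carrier_vec n" "v \<noteq> 0\<^sub>v n" for v
  proof
    assume "P *\<^sub>v v = 0\<^sub>v n"
    then have "v = Q *\<^sub>v 0\<^sub>v n" using QP[OF v(1)] by simp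
    then show False using v(2) s by auto
  qed
  from u X have u': "u \<in> carrier_vec n" "u \<noteq> 0\<^sub>v n" "X *\<^sub>v u = \<nu> \<cdot>\<^sub>v u"
    by (auto simp: eigenvector_def)
  have "Q *\<^sub>v u \<noteq> 0\<^sub>v n"
  proof
    assume "Q *\<^sub>v u = 0\<^sub>v n"
    then have "u = P *\<^sub>v 0\<^sub>v n" using PQ[OF u'(1)] by simp
    then show False using u'(2) s by auto
  qed
  then have "E n (Q *\<^sub>v u)" using u' s PQ by (auto simp: E_def)
  then have ex: "\<exists>m v. E m v" by blast
  define m where "m = (LEAST m. \<exists>v. E m v)"
  obtain v where v: "E m v" unfolding m_def using LeastI_ex[OF ex] by blast
  have min: "\<not> E k v'" if "k < m" for k v' using not_less_Least[of k] that m_def by blast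
  have vc: "v \<in> carrier_vec n" "v \<noteq> 0\<^sub>v n" and ve: "X *\<^sub>v (P *\<^sub>v v) = \<nu> \<cdot>\<^sub>v (P *\<^sub>v v)"
    and vz: "\<And>i. m \<le> i \<Longrightarrow> i < n \<Longrightarrow> v $ i = 0" using v by (auto simp: E_def)
  have mpos: "m \<noteq> 0"
  proof
    assume "m = 0"
    then have "v = 0\<^sub>v n" using vz vc(1) by (intro eq_vecI) auto
    with vc show False by simp
  qed
  have "m \<le> n"
  proof (rule ccontr)
    assume "\<not> m \<le> n"
    moreover then have "E n v" using v by (auto simp: E_def)
    ultimately show False using min[of n v] by auto
  qed
  define k where "k = m - 1"
  have k: "k < m" "k < n" "m = Suc k" using mpos \<open>m \<le> n\<close> by (auto simp: k_def)
  define b where "b = B $$ (k, k)"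
  define v' where "v' = B *\<^sub>v v - b \<cdot>\<^sub>v v"
  have Bv: "B *\<^sub>v v \<in> carrier_vec n" using s vc by auto
  have v'c: "v' \<in> carrier_vec n" using Bv vc by (simp add: v'_def)
  have "v' $ i = 0" if i: "k \<le> i" "i < n" for i
  proof -
    have "(B *\<^sub>v v) $ i = (\<Sum>j<n. B $$ (i, j) * v $ j)"
      using s vc i by (simp add: scalar_prod_def atLeast0LessThan)
    also have "\<dots> = (\<Sum>j<n. if j = k then (if i = k then b * v $ k else 0) else 0)"
    proof (rule sum.cong)
      fix j assume j: "j \<in> {..<n}"
      consider "j < k" | "j = k" | "m \<le> j" using k by linarith
      then show "B $$ (i, j) * v $ j = (if j = k then (if i = k then b * v $ k else 0) else 0)"
      proof cases
        case 1
        then have "B $$ (i, j) = 0" using upper_triangularD[OF ut, of j i] i s(5) by auto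
        with 1 show ?thesis by simp
      next
        case 2
        then show ?thesis using upper_triangularD[OF ut, of k i] i s(5) by (auto simp: b_def)
      next
        case 3
        then show ?thesis using vz[of j] j k by auto
      qed
    qed simp
    also have "\<dots> = (if i = k then b * v $ k else 0)" using k by simp
    finally have "(B *\<^sub>v v) $ i = (if i = k then b * v $ k else 0)" .
    moreover have "v $ i = 0" if "i \<noteq> k" using vz[of i] i k that by auto
    ultimately show ?thesis using i vc Bv by (auto simp: v'_def)
  qed
  moreover have Pv': "P *\<^sub>v v' = A *\<^sub>v (P *\<^sub>v v) - b \<cdot>\<^sub>v (P *\<^sub>v v)"
    using s vc Bv AP[OF vc(1)] by (simp add: v'_def mult_minus_distrib_mat_vec[of _ n n] mult_mat_vec[of _ n n])
  have "X *\<^sub>v (P *\<^sub>v v') = \<nu> \<cdot>\<^sub>v (P *\<^sub>v v')"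
  proof -
    have pc: "P *\<^sub>v v \<in> carrier_vec n" "A *\<^sub>v (P *\<^sub>v v) \<in> carrier_vec n"
      using mult_mat_vec_carrier[OF s(6) vc(1)] mult_mat_vec_carrier[OF A] by blast+
    have "X *\<^sub>v (A *\<^sub>v (P *\<^sub>v v)) = (X * A) *\<^sub>v (P *\<^sub>v v)"
      by (rule assoc_mult_mat_vec[OF X A pc(1), symmetric])
    also have "\<dots> = A *\<^sub>v (X *\<^sub>v (P *\<^sub>v v))"
      unfolding comm[symmetric] by (rule assoc_mult_mat_vec[OF A X pc(1)])
    also have "\<dots> = \<nu> \<cdot>\<^sub>v (A *\<^sub>v (P *\<^sub>v v))" unfolding ve by (rule mult_mat_vec[OF A pc(1)])
    finally have XA: "X *\<^sub>v (A *\<^sub>v (P *\<^sub>v v)) = \<nu> \<cdot>\<^sub>v (A *\<^sub>v (P *\<^sub>v v))" .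
    have "X *\<^sub>v (P *\<^sub>v v') = X *\<^sub>v (A *\<^sub>v (P *\<^sub>v v)) - b \<cdot>\<^sub>v (X *\<^sub>v (P *\<^sub>v v))"
      unfolding Pv' using pc mult_minus_distrib_mat_vec[OF X pc(2), of "b \<cdot>\<^sub>v (P *\<^sub>v v)"]
      by (simp add: mult_mat_vec[OF X pc(1)])
    also have "\<dots> = \<nu> \<cdot>\<^sub>v (P *\<^sub>v v')"
      unfolding Pv' XA ve using A s(6) by (intro eq_vecI) (auto simp: algebra_simps)
    finally show ?thesis .
  qed
  ultimately have "v' = 0\<^sub>v n" using min[OF k(1), of v'] v'c by (auto simp: E_def)
  moreover have "P *\<^sub>v 0\<^sub>v n = 0\<^sub>v n" using s(6) by (intro eq_vecI) auto
  ultimately have Ab: "A *\<^sub>v (P *\<^sub>v v) - b \<cdot>\<^sub>v (P *\<^sub>v v) = 0\<^sub>v n"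
    using Pv' by simp
  have "A *\<^sub>v (P *\<^sub>v v) = b \<cdot>\<^sub>v (P *\<^sub>v v)"
  proof (rule eq_vecI)
    fix i assume "i < dim_vec (b \<cdot>\<^sub>v (P *\<^sub>v v))"
    then have i: "i < n" using s by auto
    have "(A *\<^sub>v (P *\<^sub>v v) - b \<cdot>\<^sub>v (P *\<^sub>v v)) $ i = 0" using Ab i by simp
    then show "(A *\<^sub>v (P *\<^sub>v v)) $ i = (b \<cdot>\<^sub>v (P *\<^sub>v v)) $ i" using i s A by simp
  qed (use s A in auto)
  then have "eigenvector A (P *\<^sub>v v) b" using P0[OF vc] A s vc by (auto simp: eigenvector_def)
  moreover have "eigenvector X (P *\<^sub>v v) \<nu>" using P0[OF vc] X s vc ve by (auto simp: eigenvector_def)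
  ultimately show thesis by (rule that)
qed

text \<open>The unitary \<open>X = A\<^sup>* B\<close> is not the identity, so it has an eigenvalue \<open>\<nu> \<noteq> 1\<close>; on an
  eigenvector common to \<open>A\<close> and \<open>X\<close>, the eigenvalues of \<open>B = A X\<close> and of \<open>A\<close> differ by the
  factor \<open>\<nu>\<close>.\<close>

lemma distinct_commuting_unitaries_common_eigenvector:
  assumes A: "A \<in> carrier (unitary_group n)" and B: "B \<in> carrier (unitary_group n)"
    and comm: "A * B = B * A" and ne: "A \<noteq> B"
  obtains w \<alpha> \<beta> where "eigenvector A w \<alpha>" "eigenvector B w \<beta>" "\<alpha> \<noteq> \<beta>"
proof -
  interpret U: group "unitary_group n" by (rule group_unitary_group)
  note AC = unitary_groupD(1)[OF A] and BC = unitary_groupD(1)[OF B]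
  define X where "X = mat_adjoint A * B"
  have invA: "mat_adjoint A = inv\<^bsub>unitary_group n\<^esub> A"
    using unitary_groupD[OF A] A mat_adjoint_adjoint[of A] mat_adjoint_carrier[OF AC]
    by (intro U.inv_equality[symmetric]) (auto simp: unitary_group_def)
  have adjA: "mat_adjoint A \<in> carrier (unitary_group n)" using A by (simp add: invA)
  have X: "X \<in> carrier (unitary_group n)"
    using U.m_closed[OF adjA B] by (simp add: X_def)
  note XC = unitary_groupD(1)[OF X]
  have AX: "A * X = B"
    using unitary_groupD[OF A] BC unitary_groupD(1)[OF adjA]
    by (simp add: X_def flip: assoc_mult_mat[of _ n n _ n _ n])
  have XA: "X * A = B"
    using unitary_groupD[OF A] BC unitary_groupD(1)[OF adjA]
    by (simp add: X_def assoc_mult_mat[of _ n n _ n _ n] flip: comm)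
      (simp flip: assoc_mult_mat[of _ n n _ n _ n])
  have "X \<noteq> 1\<^sub>m n" using AX AC ne by auto
  then obtain \<nu> where "eigenvalue X \<nu>" and \<nu>: "\<nu> \<noteq> 1"
    using unitary_with_all_eigenvalues_one[OF X] by blast
  then obtain u where "eigenvector X u \<nu>" by (auto simp: eigenvalue_def)
  then obtain w \<alpha> where w: "eigenvector A w \<alpha>" "eigenvector X w \<nu>"
    using common_eigenvector[OF AC XC] AX XA by metis
  have wc: "w \<in> carrier_vec n" "w \<noteq> 0\<^sub>v n" "A *\<^sub>v w = \<alpha> \<cdot>\<^sub>v w" "X *\<^sub>v w = \<nu> \<cdot>\<^sub>v w"
    using w AC XC by (auto simp: eigenvector_def)
  have "B *\<^sub>v w = A *\<^sub>v (X *\<^sub>v w)" using AX AC XC wc(1) by (simp flip: assoc_mult_mat_vec[of _ n n _ n])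
  also have "\<dots> = (\<nu> * \<alpha>) \<cdot>\<^sub>v w"
    using AC wc by (simp add: mult_mat_vec[of _ n n] smult_smult_assoc)
  finally have "eigenvector B w (\<nu> * \<alpha>)" using wc BC by (auto simp: eigenvector_def)
  moreover have "\<alpha> \<noteq> 0"
  proof
    assume "\<alpha> = 0"
    have "w = mat_adjoint A *\<^sub>v (A *\<^sub>v w)"
      using unitary_groupD[OF A] unitary_groupD(1)[OF adjA] wc(1)
      by (simp flip: assoc_mult_mat_vec[of _ n n _ n])
    also have "\<dots> = 0\<^sub>v n"
      using \<open>\<alpha> = 0\<close> wc unitary_groupD(1)[OF adjA] by (auto simp: mult_mat_vec[of _ n n])
    finally show False using wc(2) by simp
  qed
  ultimately show thesis using that[OF w(1)] \<nu> by auto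
qed

text \<open>The vector \<open>w\<close> is an eigenvector of \<open>A - B\<close> for \<open>\<alpha> - \<beta>\<close>. Reading this equation in the
  coordinate where \<open>w\<close> is largest bounds the eigenvalue by a row sum of \<open>A - B\<close>, hence by
  \<open>n\<close> times the largest entry in that row.\<close>

lemma entry_ge_eigenvalue_gap:
  fixes A B :: "complex mat"
  assumes A: "A \<in> carrier_mat n n" and B: "B \<in> carrier_mat n n"
    and "eigenvector A w \<alpha>" "eigenvector B w \<beta>"
  obtains i j where "i < n" "j < n" "cmod (\<alpha> - \<beta>) \<le> n * cmod (A $$ (i, j) - B $$ (i, j))"
proof -
  have w: "w \<in> carrier_vec n" "w \<noteq> 0\<^sub>v n" "A *\<^sub>v w = \<alpha> \<cdot>\<^sub>v w" "B *\<^sub>v w = \<beta> \<cdot>\<^sub>v w"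
    using assms by (auto simp: eigenvector_def)
  obtain i0 where i0: "i0 < n" "w $ i0 \<noteq> 0"
    using w(1,2) by (metis carrier_vecD eq_vecI index_zero_vec(1) index_zero_vec(2))
  define M where "M = Max ((\<lambda>i. cmod (w $ i)) ` {..<n})"
  have "M \<in> (\<lambda>i. cmod (w $ i)) ` {..<n}" unfolding M_def using i0 by (intro Max_in) auto
  then obtain i where i: "i < n" "M = cmod (w $ i)" by auto
  have le: "cmod (w $ j) \<le> M" if "j < n" for j using that by (auto simp: M_def)
  have M: "M > 0" using le[OF i0(1)] i0(2) by (meson less_le_trans zero_less_norm_iff)
  have row: "(C *\<^sub>v w) $ i = (\<Sum>j<n. C $$ (i, j) * w $ j)" if "C \<in> carrier_mat n n" for C
    using that i w(1) by (simp add: scalar_prod_def atLeast0LessThan)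
  have "(\<alpha> - \<beta>) * w $ i = (A *\<^sub>v w) $ i - (B *\<^sub>v w) $ i"
    using w(1,3,4) i by (simp add: left_diff_distrib)
  also have "\<dots> = (\<Sum>j<n. (A $$ (i, j) - B $$ (i, j)) * w $ j)"
    by (simp add: row A B sum_subtractf left_diff_distrib)
  finally have "cmod (\<alpha> - \<beta>) * M = cmod (\<Sum>j<n. (A $$ (i, j) - B $$ (i, j)) * w $ j)"
    using i(2) by (metis norm_mult)
  also have "\<dots> \<le> (\<Sum>j<n. cmod (A $$ (i, j) - B $$ (i, j)) * M)"
    by (rule order_trans[OF norm_sum]) (auto simp: norm_mult intro!: sum_mono mult_left_mono le)
  finally have gap: "cmod (\<alpha> - \<beta>) \<le> (\<Sum>j<n. cmod (A $$ (i, j) - B $$ (i, j)))"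
    using M by (simp flip: sum_distrib_right)
  define K where "K = Max ((\<lambda>j. cmod (A $$ (i, j) - B $$ (i, j))) ` {..<n})"
  have "K \<in> (\<lambda>j. cmod (A $$ (i, j) - B $$ (i, j))) ` {..<n}"
    unfolding K_def using i0 by (intro Max_in) auto
  then obtain j where j: "j < n" "K = cmod (A $$ (i, j) - B $$ (i, j))" by auto
  have "(\<Sum>j<n. cmod (A $$ (i, j) - B $$ (i, j))) \<le> (\<Sum>j<n. K)"
    by (intro sum_mono) (auto simp: K_def)
  then have "cmod (\<alpha> - \<beta>) \<le> n * K" using gap by simp
  then show thesis using that i j by blast
qed

text \<open>Pigeonhole: round the real and imaginary parts of all entries to multiples of \<open>e / 2\<close>. Matrices
  with the same rounding have entries at distance less than \<open>e\<close>, and boundedness leaves finitely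
  many roundings.\<close>

lemma bounded_separated_matrices_finite:
  fixes S :: "complex mat set"
  assumes S: "S \<subseteq> carrier_mat n n"
    and bd: "\<And>A i j. \<lbrakk>A \<in> S; i < n; j < n\<rbrakk> \<Longrightarrow> cmod (A $$ (i, j)) \<le> 1"
    and e: "e > 0"
    and sep: "\<And>A B. \<lbrakk>A \<in> S; B \<in> S; A \<noteq> B\<rbrakk> \<Longrightarrow>
      \<exists>i<n. \<exists>j<n. e \<le> cmod (A $$ (i, j) - B $$ (i, j))"
  shows "finite S"
proof -
  define r where "r x = \<lfloor>x * (2 / e)\<rfloor>" for x :: real
  define cell where "cell A = (\<lambda>(i, j) \<in> {..<n} \<times> {..<n}. (r (Re (A $$ (i, j))), r (Im (A $$ (i, j)))))"
    for A :: "complex mat"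
  have r_eq: "\<bar>x - y\<bar> < e / 2" if "r x = r y" for x y
  proof -
    have "\<bar>x * (2 / e) - y * (2 / e)\<bar> < 1" using that unfolding r_def by linarith
    also have "x * (2 / e) - y * (2 / e) = (x - y) * (2 / e)" by (rule left_diff_distrib[symmetric])
    also have "\<bar>(x - y) * (2 / e)\<bar> = \<bar>x - y\<bar> * (2 / e)" using e by (simp only: abs_mult) simp
    finally have "\<bar>x - y\<bar> * (2 / e) < 1" .
    then show ?thesis using e by (simp add: field_simps)
  qed
  have r_bd: "r x \<in> {- \<lceil>2 / e\<rceil>..\<lceil>2 / e\<rceil>}" if "\<bar>x\<bar> \<le> 1" for x
  proof -
    have "\<bar>x\<bar> * (2 / e) \<le> 1 * (2 / e)" using that e by (intro mult_right_mono) auto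
    then have "\<bar>x * (2 / e)\<bar> \<le> 2 / e" using e by (simp add: abs_mult)
    then have "- \<lceil>2 / e\<rceil> \<le> x * (2 / e)" "x * (2 / e) \<le> \<lceil>2 / e\<rceil>" by linarith+
    then show ?thesis unfolding r_def by (auto simp: le_floor_iff floor_le_iff) 
  qed
  have "inj_on cell S"
  proof (rule inj_onI, rule ccontr)
    fix A B assume AB: "A \<in> S" "B \<in> S" "cell A = cell B" "A \<noteq> B"
    then obtain i j where ij: "i < n" "j < n" "e \<le> cmod (A $$ (i, j) - B $$ (i, j))"
      using sep by blast
    have "cell A (i, j) = cell B (i, j)" using AB by simp
    then have "r (Re (A $$ (i, j))) = r (Re (B $$ (i, j)))" "r (Im (A $$ (i, j))) = r (Im (B $$ (i, j)))"
      using ij by (auto simp: cell_def)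
    then have "\<bar>Re (A $$ (i, j) - B $$ (i, j))\<bar> < e / 2" "\<bar>Im (A $$ (i, j) - B $$ (i, j))\<bar> < e / 2"
      by (auto dest: r_eq)
    then show False using cmod_le[of "A $$ (i, j) - B $$ (i, j)"] ij(3) by linarith
  qed
  moreover have "cell ` S \<subseteq> ({..<n} \<times> {..<n}) \<rightarrow>\<^sub>E ({- \<lceil>2 / e\<rceil>..\<lceil>2 / e\<rceil>} \<times> {- \<lceil>2 / e\<rceil>..\<lceil>2 / e\<rceil>})"
  proof (intro image_subsetI PiE_I)
    fix A p assume A: "A \<in> S" and p: "p \<in> {..<n} \<times> {..<n}"
    obtain i j where ij: "p = (i, j)" "i < n" "j < n" using p by auto
    have "\<bar>Re (A $$ (i, j))\<bar> \<le> 1" "\<bar>Im (A $$ (i, j))\<bar> \<le> 1"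
      using bd[OF A ij(2,3)] abs_Re_le_cmod[of "A $$ (i, j)"] abs_Im_le_cmod[of "A $$ (i, j)"] by linarith+
    then show "cell A p \<in> {- \<lceil>2 / e\<rceil>..\<lceil>2 / e\<rceil>} \<times> {- \<lceil>2 / e\<rceil>..\<lceil>2 / e\<rceil>}"
      using r_bd ij by (auto simp: cell_def simp del: atLeastAtMost_iff)
  qed (auto simp: cell_def)
  then have "finite (cell ` S)" by (rule finite_subset) (intro finite_PiE finite_SigmaI; simp)
  ultimately show ?thesis by (rule finite_imageD[rotated])
qed

text \<open>Distinct members of the family differ, on a common eigenvector, by at least the smallest gap
  between points of \<open>\<Lambda>\<close>. So the family is a uniformly separated subset of a bounded set.\<close>

lemma commuting_unitaries_finite:
  assumes S: "S \<subseteq> carrier (unitary_group n)"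
    and comm: "\<And>A B. \<lbrakk>A \<in> S; B \<in> S\<rbrakk> \<Longrightarrow> A * B = B * A"
    and fin: "finite \<Lambda>" and spec: "\<And>A \<alpha>. \<lbrakk>A \<in> S; eigenvalue A \<alpha>\<rbrakk> \<Longrightarrow> \<alpha> \<in> \<Lambda>"
  shows "finite S"
proof -
  \<comment> \<open>Inserting \<open>1\<close> keeps the set nonempty when \<open>\<Lambda>\<close> has at most one point.\<close>
  define gaps where "gaps = insert 1 ((\<lambda>(\<alpha>, \<beta>). cmod (\<alpha> - \<beta>)) ` {(\<alpha>, \<beta>) \<in> \<Lambda> \<times> \<Lambda>. \<alpha> \<noteq> \<beta>})"
  have "finite {(\<alpha>, \<beta>) \<in> \<Lambda> \<times> \<Lambda>. \<alpha> \<noteq> \<beta>}"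
    by (rule finite_subset[of _ "\<Lambda> \<times> \<Lambda>"]) (use fin in auto)
  then have fg: "finite gaps" "gaps \<noteq> {}" by (auto simp: gaps_def)
  define c where "c = Min gaps"
  have c: "c > 0" unfolding c_def using fg by (subst Min_gr_iff) (auto simp: gaps_def)
  show ?thesis
  \<comment> \<open>Dividing by \<open>Suc n\<close> instead of \<open>n\<close> keeps the bound positive in dimension \<open>0\<close>.\<close>
  proof (rule bounded_separated_matrices_finite[of S n "c / Suc n"])
    show "S \<subseteq> carrier_mat n n" using S unitary_groupD(1) by blast
    show "cmod (A $$ (i, j)) \<le> 1" if "A \<in> S" "i < n" "j < n" for A i j
      using that S unitary_entry_le_1 by blast
    show "c / Suc n > 0" using c by simp
    fix A B assume AB: "A \<in> S" "B \<in> S" "A \<noteq> B"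
    then have U: "A \<in> carrier (unitary_group n)" "B \<in> carrier (unitary_group n)" using S by auto
    obtain w \<alpha> \<beta> where w: "eigenvector A w \<alpha>" "eigenvector B w \<beta>" "\<alpha> \<noteq> \<beta>"
      using distinct_commuting_unitaries_common_eigenvector[OF U comm[OF AB(1,2)] AB(3)] .
    then have "(\<alpha>, \<beta>) \<in> {(\<alpha>, \<beta>) \<in> \<Lambda> \<times> \<Lambda>. \<alpha> \<noteq> \<beta>}" using spec AB by (auto simp: eigenvalue_def)
    then have "cmod (\<alpha> - \<beta>) \<in> gaps" unfolding gaps_def by force
    then have cl: "c \<le> cmod (\<alpha> - \<beta>)" using fg by (auto simp: c_def)
    obtain i j where ij: "i < n" "j < n" "cmod (\<alpha> - \<beta>) \<le> n * cmod (A $$ (i, j) - B $$ (i, j))"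
      using entry_ge_eigenvalue_gap[OF unitary_groupD(1)[OF U(1)] unitary_groupD(1)[OF U(2)] w(1,2)] .
    have "c \<le> Suc n * cmod (A $$ (i, j) - B $$ (i, j))"
      using cl ij(3) norm_ge_zero[of "A $$ (i, j) - B $$ (i, j)"]
      unfolding of_nat_Suc distrib_right mult_1 by linarith
    then have "c / Suc n \<le> cmod (A $$ (i, j) - B $$ (i, j))" by (simp add: field_simps)
    with ij show "\<exists>i<n. \<exists>j<n. c / Suc n \<le> cmod (A $$ (i, j) - B $$ (i, j))" by blast
  qed
qed

section \<open>Induced representations of semidirect products\<close>

text \<open>Matrix coefficients indexed by an arbitrary finite set are easier to handle than matrices
  indexed by an initial segment of the natural numbers; an enumeration of \<open>I\<close> translates between
  the two.\<close>

lemma unitary_representation_on_finite_set: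
  fixes M :: "'a \<Rightarrow> 'i \<Rightarrow> 'i \<Rightarrow> complex"
  assumes fin: "finite I"
    and mult: "\<And>x y i j. \<lbrakk>x \<in> carrier K; y \<in> carrier K; i \<in> I; j \<in> I\<rbrakk> \<Longrightarrow>
      M (x \<otimes>\<^bsub>K\<^esub> y) i j = (\<Sum>k\<in>I. M x i k * M y k j)"
    and unit: "\<And>x i j. \<lbrakk>x \<in> carrier K; i \<in> I; j \<in> I\<rbrakk> \<Longrightarrow>
      (\<Sum>k\<in>I. M x i k * cnj (M x j k)) = (if i = j then 1 else 0)"
    and sep: "i \<in> I" "j \<in> I" "M x i j \<noteq> M y i j"
  shows "\<exists>n. \<exists>\<rho> \<in> hom K (unitary_group n). \<rho> x \<noteq> \<rho> y"
proof -
  define n where "n = card I"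
  obtain e where e: "bij_betw e {..<n} I"
    using ex_bij_betw_nat_finite[OF fin] by (auto simp: n_def atLeast0LessThan)
  have eI: "e k \<in> I" if "k < n" for k using e that by (auto simp: bij_betw_def)
  have inj: "e k = e l \<longleftrightarrow> k = l" if "k < n" "l < n" for k l
    using e that by (auto simp: bij_betw_def inj_on_def)
  have reindex: "(\<Sum>k<n. f (e k)) = sum f I" for f :: "'i \<Rightarrow> complex"
    by (rule sum.reindex_bij_betw[OF e])
  define \<rho> where "\<rho> x = mat n n (\<lambda>(k, l). M x (e k) (e l))" for x
  have "\<rho> \<in> hom K (unitary_group n)"
  proof (rule homI)
    fix x assume x: "x \<in> carrier K"
    show "\<rho> x \<in> carrier (unitary_group n)"
    proof (rule unitary_groupI)
      fix k l assume kl: "k < n" "l < n"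
      have "(\<Sum>m<n. \<rho> x $$ (k, m) * cnj (\<rho> x $$ (l, m))) = (\<Sum>m<n. M x (e k) (e m) * cnj (M x (e l) (e m)))"
        using kl by (simp add: \<rho>_def)
      also have "\<dots> = (if k = l then 1 else 0)"
        using unit[OF x eI[OF kl(1)] eI[OF kl(2)]] inj[OF kl]
          reindex[of "\<lambda>m. M x (e k) m * cnj (M x (e l) m)"] by simp
      finally show "(\<Sum>m<n. \<rho> x $$ (k, m) * cnj (\<rho> x $$ (l, m))) = (if k = l then 1 else 0)" .
    qed (simp add: \<rho>_def)
  next
    fix x y assume xy: "x \<in> carrier K" "y \<in> carrier K"
    have "\<rho> (x \<otimes>\<^bsub>K\<^esub> y) = \<rho> x * \<rho> y"
    proof (rule eq_matI)
      fix k l assume "k < dim_row (\<rho> x * \<rho> y)" "l < dim_col (\<rho> x * \<rho> y)"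
      then have kl: "k < n" "l < n" by (auto simp: \<rho>_def)
      then show "\<rho> (x \<otimes>\<^bsub>K\<^esub> y) $$ (k, l) = (\<rho> x * \<rho> y) $$ (k, l)"
        using mult[OF xy eI[OF kl(1)] eI[OF kl(2)]]
          reindex[of "\<lambda>m. M x (e k) m * M y m (e l)"]
        by (simp add: \<rho>_def scalar_prod_def atLeast0LessThan)
    qed (auto simp: \<rho>_def)
    then show "\<rho> (x \<otimes>\<^bsub>K\<^esub> y) = \<rho> x \<otimes>\<^bsub>unitary_group n\<^esub> \<rho> y" by simp
  qed
  moreover obtain k l where "k < n" "l < n" "e k = i" "e l = j"
    using e sep(1,2) unfolding bij_betw_def by (metis imageE lessThan_iff)
  then have "\<rho> x $$ (k, l) \<noteq> \<rho> y $$ (k, l)" using sep(3) by (simp add: \<rho>_def)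
  then have "\<rho> x \<noteq> \<rho> y" by auto
  ultimately show ?thesis by blast
qed

lemma semidirect_product_simps [simp]:
  "carrier (semidirect_product N G \<alpha>) = carrier N \<times> carrier G"
  "(a, g) \<otimes>\<^bsub>semidirect_product N G \<alpha>\<^esub> (b, h) = (a \<otimes>\<^bsub>N\<^esub> \<alpha> g b, g \<otimes>\<^bsub>G\<^esub> h)"
  by (auto simp: semidirect_product_def)

text \<open>The representation acts on functions \<open>F \<rightarrow> \<complex>\<^sup>n\<close>: an element \<open>(f, g)\<close> permutes the arguments by left
  multiplication with \<open>\<phi> g\<close> and then applies the matrix \<open>\<tau> a f\<close> to the value at \<open>a\<close>. The
  equivariance of \<open>\<tau>\<close> is exactly what makes this compatible with the twisted multiplication.
  The block permutation underlying \<open>(f, g)\<close> detects \<open>\<phi> g\<close>, and its blocks detect the \<open>\<tau> a f\<close>.\<close>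

lemma induced_representation:
  fixes F :: "('f, 'l) monoid_scheme"
  assumes F: "group F" "finite (carrier F)" and \<phi>: "\<phi> \<in> hom G F"
    and closed: "\<And>g f. \<lbrakk>g \<in> carrier G; f \<in> carrier N\<rbrakk> \<Longrightarrow> \<alpha> g f \<in> carrier N"
    and \<tau>: "\<And>a. a \<in> carrier F \<Longrightarrow> \<tau> a \<in> hom N (unitary_group n)"
    and equiv: "\<And>a f g. \<lbrakk>a \<in> carrier F; f \<in> carrier N; g \<in> carrier G\<rbrakk> \<Longrightarrow>
      \<tau> (\<phi> g \<otimes>\<^bsub>F\<^esub> a) (\<alpha> g f) = \<tau> a f"
    and fg: "f \<in> carrier N" "g \<in> carrier G" and fg': "f' \<in> carrier N" "g' \<in> carrier G"
    and sep: "(\<phi> g \<noteq> \<phi> g' \<and> n > 0) \<or> (\<exists>a \<in> carrier F. \<tau> a f \<noteq> \<tau> a f')"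
  shows "\<exists>m. \<exists>\<rho> \<in> hom (semidirect_product N G \<alpha>) (unitary_group m). \<rho> (f, g) \<noteq> \<rho> (f', g')"
proof -
  interpret F: group F by (rule F(1))
  have \<phi>c: "\<phi> g \<in> carrier F" if "g \<in> carrier G" for g using \<phi> that by (auto simp: hom_def)
  have \<phi>m: "\<phi> (g \<otimes>\<^bsub>G\<^esub> h) = \<phi> g \<otimes>\<^bsub>F\<^esub> \<phi> h" if "g \<in> carrier G" "h \<in> carrier G" for g h
    using \<phi> that by (auto simp: hom_def)
  have \<tau>c: "\<tau> a f \<in> carrier (unitary_group n)" if "a \<in> carrier F" "f \<in> carrier N" for a f
    using \<tau>[OF that(1)] that(2) by (auto simp: hom_def)
  note \<tau>mat = unitary_groupD(1)[OF \<tau>c]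
  have \<tau>m: "\<tau> a (f \<otimes>\<^bsub>N\<^esub> h) = \<tau> a f * \<tau> a h"
    if "a \<in> carrier F" "f \<in> carrier N" "h \<in> carrier N" for a f h
    using \<tau>[OF that(1)] that by (auto simp: hom_def)
  define I where "I = carrier F \<times> {..<n}"
  define M where "M = (\<lambda>(f, g) (a, r) (b, s). if a = \<phi> g \<otimes>\<^bsub>F\<^esub> b then \<tau> a f $$ (r, s) else 0)"
  have M: "M (f, g) (a, r) (b, s) = (if b = inv\<^bsub>F\<^esub> \<phi> g \<otimes>\<^bsub>F\<^esub> a then \<tau> a f $$ (r, s) else 0)"
    if "g \<in> carrier G" "a \<in> carrier F" "b \<in> carrier F" for f g a b r s
    using that \<phi>c[OF that(1)] by (auto simp: M_def F.inv_solve_left)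
  have sum_I: "(\<Sum>k\<in>I. h k) = (\<Sum>c\<in>carrier F. \<Sum>t<n. h (c, t))" for h :: "'f \<times> nat \<Rightarrow> complex"
    by (simp add: I_def sum.cartesian_product)
  \<comment> \<open>Only one block contributes to the sums that compute a product of block permutation matrices.\<close>
  have collapse: "(\<Sum>c\<in>carrier F. \<Sum>t<n. if c = d then u t else 0) = (\<Sum>t<n. u t)"
    if "d \<in> carrier F" for d and u :: "nat \<Rightarrow> complex"
  proof -
    have "(\<Sum>c\<in>carrier F. \<Sum>t<n. if c = d then u t else 0)
      = (\<Sum>c\<in>carrier F. if c = d then (\<Sum>t<n. u t) else 0)"
      by (intro sum.cong) auto
    then show ?thesis using F(2) that by simp
  qed
  have "\<exists>i\<in>I. \<exists>j\<in>I. M (f, g) i j \<noteq> M (f', g') i j"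
  proof (cases "\<phi> g = \<phi> g'")
    case False
    with sep F(1) have n: "n > 0" using \<tau>mat[OF _ fg(1)] \<tau>mat[OF _ fg'(1)] by (fastforce intro: eq_matI)
    have "\<exists>s<n. \<tau> (\<phi> g) f $$ (0, s) \<noteq> 0"
      using unitary_row_orthonormal[OF \<tau>c[OF \<phi>c[OF fg(2)] fg(1)] n n]
      by (metis (no_types, lifting) lessThan_iff mult_zero_left sum.neutral zero_neq_one)
    then obtain s where s: "s < n" "\<tau> (\<phi> g) f $$ (0, s) \<noteq> 0" by blast
    have "M (f, g) (\<phi> g, 0) (\<one>\<^bsub>F\<^esub>, s) \<noteq> M (f', g') (\<phi> g, 0) (\<one>\<^bsub>F\<^esub>, s)"
      using False s \<phi>c fg fg' by (simp add: M_def)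
    then show ?thesis using n s \<phi>c fg unfolding I_def by blast
  next
    case True
    with sep obtain a where a: "a \<in> carrier F" "\<tau> a f \<noteq> \<tau> a f'" by auto
    then obtain r s where rs: "r < n" "s < n" "\<tau> a f $$ (r, s) \<noteq> \<tau> a f' $$ (r, s)"
      using \<tau>mat[OF a(1) fg(1)] \<tau>mat[OF a(1) fg'(1)] eq_matI[of "\<tau> a f'" "\<tau> a f"] by auto
    define b where "b = inv\<^bsub>F\<^esub> \<phi> g \<otimes>\<^bsub>F\<^esub> a"
    have b: "b \<in> carrier F" using a \<phi>c fg by (simp add: b_def)
    have "M (f, g) (a, r) (b, s) \<noteq> M (f', g') (a, r) (b, s)"
      unfolding M[OF fg(2) a(1) b] M[OF fg'(2) a(1) b] using rs True by (simp add: b_def)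
    then show ?thesis using a b rs unfolding I_def by blast
  qed
  then obtain i j where ij: "i \<in> I" "j \<in> I" "M (f, g) i j \<noteq> M (f', g') i j" by blast
  show ?thesis
  proof (rule unitary_representation_on_finite_set[where M = M, OF _ _ _ ij])
    show "finite I" using F(2) by (simp add: I_def)
  next
    fix x y i j
    assume "x \<in> carrier (semidirect_product N G \<alpha>)" "y \<in> carrier (semidirect_product N G \<alpha>)" "i \<in> I" "j \<in> I"
    then obtain f g h k a r b s where x: "x = (f, g)" "f \<in> carrier N" "g \<in> carrier G"
      and y: "y = (h, k)" "h \<in> carrier N" "k \<in> carrier G"
      and i: "i = (a, r)" "a \<in> carrier F" "r < n" and j: "j = (b, s)" "b \<in> carrier F" "s < n"
      by (auto simp: I_def)
    \<comment> \<open>In row block \<open>a\<close> of the matrix of \<open>(f, g)\<close> only the column block \<open>c\<close> is nonzero.\<close>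
    define c where "c = inv\<^bsub>F\<^esub> \<phi> g \<otimes>\<^bsub>F\<^esub> a"
    have c: "c \<in> carrier F" "a = \<phi> g \<otimes>\<^bsub>F\<^esub> c" using \<phi>c[OF x(3)] i by (auto simp: c_def F.inv_solve_left' simp flip: F.m_assoc)
    have \<tau>eq: "\<tau> a (\<alpha> g h) = \<tau> c h" using equiv[OF c(1) y(2) x(3)] c(2) by simp
    have "(\<Sum>l\<in>I. M x i l * M y l j)
      = (\<Sum>d\<in>carrier F. \<Sum>t<n. if d = c then \<tau> a f $$ (r, t) * M y (c, t) j else 0)"
      unfolding sum_I x(1) i(1) by (intro sum.cong) (auto simp: M[OF x(3) i(2)] c_def)
    also have "\<dots> = (\<Sum>t<n. \<tau> a f $$ (r, t) * M y (c, t) j)" by (rule collapse[OF c(1)])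
    also have "\<dots> = (if c = \<phi> k \<otimes>\<^bsub>F\<^esub> b then (\<Sum>t<n. \<tau> a f $$ (r, t) * \<tau> c h $$ (t, s)) else 0)"
      by (simp add: y j M_def)
    also have "(c = \<phi> k \<otimes>\<^bsub>F\<^esub> b) = (a = \<phi> (g \<otimes>\<^bsub>G\<^esub> k) \<otimes>\<^bsub>F\<^esub> b)"
      using c \<phi>c x y j by (simp add: \<phi>m F.m_assoc)
    also have "(\<Sum>t<n. \<tau> a f $$ (r, t) * \<tau> c h $$ (t, s)) = \<tau> a (f \<otimes>\<^bsub>N\<^esub> \<alpha> g h) $$ (r, s)"
      using \<tau>m[OF i(2) x(2) closed[OF x(3) y(2)]] \<tau>eq \<tau>mat[OF i(2) x(2)] \<tau>mat[OF c(1) y(2)] i j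
      by (simp add: scalar_prod_def atLeast0LessThan)
    finally show "M (x \<otimes>\<^bsub>semidirect_product N G \<alpha>\<^esub> y) i j = (\<Sum>l\<in>I. M x i l * M y l j)"
      by (simp add: x(1) y(1) i(1) j(1) M_def)
  next
    fix x i j assume "x \<in> carrier (semidirect_product N G \<alpha>)" "i \<in> I" "j \<in> I"
    then obtain f g a r b s where x: "x = (f, g)" "f \<in> carrier N" "g \<in> carrier G"
      and i: "i = (a, r)" "a \<in> carrier F" "r < n" and j: "j = (b, s)" "b \<in> carrier F" "s < n"
      by (auto simp: I_def)
    define c where "c = inv\<^bsub>F\<^esub> \<phi> g \<otimes>\<^bsub>F\<^esub> a"
    have c: "c \<in> carrier F" using \<phi>c[OF x(3)] i by (auto simp: c_def)
    have cb: "c = inv\<^bsub>F\<^esub> \<phi> g \<otimes>\<^bsub>F\<^esub> b \<longleftrightarrow> a = b"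
      using \<phi>c[OF x(3)] i j by (simp add: c_def)
    have "(\<Sum>l\<in>I. M x i l * cnj (M x j l))
      = (\<Sum>d\<in>carrier F. \<Sum>t<n. if d = c then (if a = b then \<tau> a f $$ (r, t) * cnj (\<tau> b f $$ (s, t)) else 0) else 0)"
      unfolding sum_I x(1) i(1) j(1)
      by (intro sum.cong) (use cb in \<open>auto simp: M[OF x(3) i(2)] M[OF x(3) j(2)] c_def\<close>)
    also have "\<dots> = (if a = b then (\<Sum>t<n. \<tau> a f $$ (r, t) * cnj (\<tau> b f $$ (s, t))) else 0)"
      unfolding collapse[OF c] by simp
    also have "\<dots> = (if i = j then 1 else 0)"
      using unitary_row_orthonormal[OF \<tau>c[OF i(2) x(2)] i(3) j(3)] by (auto simp: i j)
    finally show "(\<Sum>l\<in>I. M x i l * cnj (M x j l)) = (if i = j then 1 else 0)" .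
  qed
qed

section \<open>Characters of abelian groups\<close>

definition circle_group :: "complex monoid"
  where "circle_group = \<lparr>carrier = {z. cmod z = 1}, monoid.mult = (*), one = 1\<rparr>"

lemma circle_group_simps [simp]:
  "carrier circle_group = {z. cmod z = 1}"
  "z \<otimes>\<^bsub>circle_group\<^esub> w = z * w"
  "\<one>\<^bsub>circle_group\<^esub> = 1"
  by (auto simp: circle_group_def)

lemma comm_group_circle_group: "comm_group circle_group"
proof (rule comm_groupI)
  fix z assume "z \<in> carrier circle_group"
  moreover from this have "z \<noteq> 0" by auto
  ultimately show "\<exists>w\<in>carrier circle_group. w \<otimes>\<^bsub>circle_group\<^esub> z = \<one>\<^bsub>circle_group\<^esub>"
    by (intro bexI[of _ "inverse z"]) (auto simp: norm_inverse)
qed (auto simp: norm_mult)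

interpretation circle: comm_group circle_group
  rewrites "carrier circle_group = {z. cmod z = 1}"
    and "\<And>z w. z \<otimes>\<^bsub>circle_group\<^esub> w = z * w"
    and "\<one>\<^bsub>circle_group\<^esub> = 1"
  by (rule comm_group_circle_group) auto

lemma circle_nat_pow: "z [^]\<^bsub>circle_group\<^esub> (m :: nat) = z ^ m"
  by (induction m) (auto simp: nat_pow_def mult.commute)

text \<open>A root other than \<open>1\<close> exists as soon as \<open>m \<ge> 2\<close>: if the principal root is \<open>1\<close>, then \<open>z = 1\<close>
  and a primitive \<open>m\<close>-th root of unity will do.\<close>

lemma circle_root:
  assumes "cmod z = 1" "m > 0"
  obtains w where "cmod w = 1" "w ^ m = z" "m \<ge> 2 \<Longrightarrow> w \<noteq> 1"
proof -
  define v where "v = cis (Arg z / m)"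
  have v: "cmod v = 1" "v ^ m = z"
    using assms cis_Arg[of z] by (force simp: v_def DeMoivre sgn_eq)+
  show thesis
  proof (cases "v = 1 \<and> m \<ge> 2")
    case False
    with v that show thesis by blast
  next
    case True
    let ?u = "cis (2 * pi / m)"
    have "cos (2 * pi / m) < cos 0"
      using True by (intro cos_monotone_0_pi) (auto simp: field_simps)
    then have "?u \<noteq> 1" by (auto simp: complex_eq_iff)
    moreover have "?u ^ m = z" using True v assms by (simp add: DeMoivre)
    ultimately show thesis using that[of ?u] by simp
  qed
qed

text \<open>A character of a subgroup of \<open>H\<close> is represented by its graph. Graphs are closed under unions of
  chains, and the graphs of homomorphisms on subgroups of \<open>H\<close> are the subgroups of \<open>H \<times>\<times> circle_group\<close> that meet
  \<open>{\<one>} \<times> circle_group\<close> trivially.\<close>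

definition partial_character :: "('a, 'm) monoid_scheme \<Rightarrow> ('a \<times> complex) set \<Rightarrow> bool"
  where "partial_character H \<Gamma> \<longleftrightarrow>
    subgroup \<Gamma> (H \<times>\<times> circle_group) \<and> (\<forall>z. (\<one>\<^bsub>H\<^esub>, z) \<in> \<Gamma> \<longrightarrow> z = 1)"

lemma DirProd_int_pow:
  assumes "group G" "group K" "a \<in> carrier G" "b \<in> carrier K"
  shows "(a, b) [^]\<^bsub>G \<times>\<times> K\<^esub> (k :: int) = (a [^]\<^bsub>G\<^esub> k, b [^]\<^bsub>K\<^esub> k)"
proof -
  interpret D: group "G \<times>\<times> K" using assms by (intro DirProd_group)
  interpret G: group G by (rule assms)
  interpret K: group K by (rule assms)
  have ab: "(a, b) \<in> carrier (G \<times>\<times> K)" using assms by simp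
  have "fst ((a, b) [^]\<^bsub>G \<times>\<times> K\<^esub> k) = fst (a, b) [^]\<^bsub>G\<^esub> k"
    by (rule group_hom.hom_int_pow[OF _ ab]) (auto intro!: group_hom.intro group_hom_axioms.intro homI simp: D.is_group G.is_group)
  moreover have "snd ((a, b) [^]\<^bsub>G \<times>\<times> K\<^esub> k) = snd (a, b) [^]\<^bsub>K\<^esub> k"
    by (rule group_hom.hom_int_pow[OF _ ab]) (auto intro!: group_hom.intro group_hom_axioms.intro homI simp: D.is_group K.is_group)
  ultimately show ?thesis by (simp add: prod_eq_iff)
qed

context
  fixes H :: "('a, 'm) monoid_scheme"
  assumes H: "comm_group H"
begin

interpretation H: comm_group H by (rule H)

interpretation D: group "H \<times>\<times> circle_group"
  by (intro DirProd_group H.is_group circle.is_group)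

lemma partial_character_closed:
  assumes "partial_character H \<Gamma>"
  shows "(a, z) \<in> \<Gamma> \<Longrightarrow> a \<in> carrier H \<and> cmod z = 1"
    and "(\<one>\<^bsub>H\<^esub>, 1) \<in> \<Gamma>"
    and "\<lbrakk>(a, z) \<in> \<Gamma>; (b, w) \<in> \<Gamma>\<rbrakk> \<Longrightarrow> (a \<otimes>\<^bsub>H\<^esub> b, z * w) \<in> \<Gamma>"
    and "(a, z) \<in> \<Gamma> \<Longrightarrow> (a [^]\<^bsub>H\<^esub> (k :: int), z [^]\<^bsub>circle_group\<^esub> k) \<in> \<Gamma>"
proof -
  have \<Gamma>: "subgroup \<Gamma> (H \<times>\<times> circle_group)" using assms by (simp add: partial_character_def)
  show car: "(a, z) \<in> \<Gamma> \<Longrightarrow> a \<in> carrier H \<and> cmod z = 1" for a z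
    using subgroup.subset[OF \<Gamma>] by auto
  show "(\<one>\<^bsub>H\<^esub>, 1) \<in> \<Gamma>" using subgroup.one_closed[OF \<Gamma>] by simp
  show "\<lbrakk>(a, z) \<in> \<Gamma>; (b, w) \<in> \<Gamma>\<rbrakk> \<Longrightarrow> (a \<otimes>\<^bsub>H\<^esub> b, z * w) \<in> \<Gamma>"
    using subgroup.m_closed[OF \<Gamma>, of "(a, z)" "(b, w)"] by simp
  show "(a [^]\<^bsub>H\<^esub> k, z [^]\<^bsub>circle_group\<^esub> k) \<in> \<Gamma>" if az: "(a, z) \<in> \<Gamma>"
    using D.subgroup_int_pow_closed[OF \<Gamma> az, of k] car[OF az]
    by (simp add: DirProd_int_pow[OF H.is_group circle.is_group])
qed

lemma partial_character_unique:
  assumes \<Gamma>: "partial_character H \<Gamma>" and z: "(a, z) \<in> \<Gamma>" and w: "(a, w) \<in> \<Gamma>"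
  shows "z = w"
proof -
  note c = partial_character_closed[OF \<Gamma>]
  have "(a \<otimes>\<^bsub>H\<^esub> a [^]\<^bsub>H\<^esub> (-1 :: int), z * w [^]\<^bsub>circle_group\<^esub> (-1 :: int)) \<in> \<Gamma>"
    using c(3)[OF z c(4)[OF w]] .
  moreover have "a \<otimes>\<^bsub>H\<^esub> a [^]\<^bsub>H\<^esub> (-1 :: int) = \<one>\<^bsub>H\<^esub>" using c(1)[OF z] by (simp add: H.int_pow_neg)
  ultimately have "z * w [^]\<^bsub>circle_group\<^esub> (-1 :: int) = 1"
    using \<Gamma> by (auto simp: partial_character_def)
  then have "z * inv\<^bsub>circle_group\<^esub> w = 1" using c(1)[OF w] by (simp add: circle.int_pow_neg)
  then have "z * inv\<^bsub>circle_group\<^esub> w * w = w" by simp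
  moreover have "inv\<^bsub>circle_group\<^esub> w * w = 1" using c(1)[OF w] circle.l_inv[of w] by simp
  ultimately show ?thesis by (simp add: mult.assoc)
qed

text \<open>If no positive power of \<open>x\<close> lies in the domain, every value is compatible with \<open>\<Gamma>\<close>, and \<open>-1\<close> is
  taken to have one different from \<open>1\<close>. Otherwise let \<open>x\<^sup>m\<close> be the least positive power in
  the domain. The powers of \<open>x\<close> in the domain are then the powers of \<open>x\<^sup>m\<close>, so any \<open>m\<close>-th root
  of the value at \<open>x\<^sup>m\<close> is compatible. Here \<open>m \<ge> 2\<close> if \<open>x\<close> itself is not in the domain, so there
  is a root other than \<open>1\<close>.\<close>

lemma partial_character_value_exists:
  assumes \<Gamma>: "partial_character H \<Gamma>" and x: "x \<in> carrier H"
  obtains w where "cmod w = 1"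
    "\<And>(k :: int) z. (x [^]\<^bsub>H\<^esub> k, z) \<in> \<Gamma> \<Longrightarrow> z = w [^]\<^bsub>circle_group\<^esub> k"
    "(\<And>z. (x, z) \<notin> \<Gamma>) \<Longrightarrow> w \<noteq> 1"
proof -
  note c = partial_character_closed[OF \<Gamma>]
  define J where "J k \<longleftrightarrow> (\<exists>z. (x [^]\<^bsub>H\<^esub> k, z) \<in> \<Gamma>)" for k :: int
  show thesis
  proof (cases "\<exists>m>0. J (int m)")
    case False
    have J0: "k = 0" if k: "J k" for k
    proof (rule ccontr)
      assume "k \<noteq> 0"
      moreover have "J (- k)"
      proof -
        obtain z where "(x [^]\<^bsub>H\<^esub> k, z) \<in> \<Gamma>" using k by (auto simp: J_def)
        from c(4)[OF this, of "-1"] show ?thesis using x by (auto simp: J_def H.int_pow_pow)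
      qed
      ultimately have "nat \<bar>k\<bar> > 0" "J (int (nat \<bar>k\<bar>))" using k by (auto simp: abs_if)
      then show False using False by blast
    qed
    have pow: "z = (-1) [^]\<^bsub>circle_group\<^esub> k" if z: "(x [^]\<^bsub>H\<^esub> k, z) \<in> \<Gamma>" for k :: int and z
    proof -
      have "k = 0" using z by (intro J0) (auto simp: J_def)
      then show ?thesis using partial_character_unique[OF \<Gamma> z, of 1] c(2) by simp
    qed
    show thesis by (rule that[of "-1", OF _ pow]) auto
  next
    case True
    define m where "m = (LEAST m. m > 0 \<and> J (int m))"
    have m: "m > 0" "J (int m)" using LeastI_ex[OF True] by (auto simp: m_def)
    have min: "\<not> J (int r)" if "0 < r" "r < m" for r
      using that not_less_Least[of r "\<lambda>m. m > 0 \<and> J (int m)"] by (auto simp: m_def)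
    obtain z0 where z0: "(x [^]\<^bsub>H\<^esub> int m, z0) \<in> \<Gamma>" using m by (auto simp: J_def)
    obtain w where w: "cmod w = 1" "w ^ m = z0" "m \<ge> 2 \<Longrightarrow> w \<noteq> 1"
      using circle_root[OF conjunct2[OF c(1)[OF z0]] m(1)] by blast
    have wm: "w [^]\<^bsub>circle_group\<^esub> int m = z0" using w by (simp add: int_pow_int circle_nat_pow)
    have "z = w [^]\<^bsub>circle_group\<^esub> k" if z: "(x [^]\<^bsub>H\<^esub> k, z) \<in> \<Gamma>" for k :: int and z
    proof -
      define q r where "q = k div int m" and "r = k mod int m"
      have k: "k = int m * q + r" "0 \<le> r" "r < int m" using m(1) by (auto simp: q_def r_def)
      have "(x [^]\<^bsub>H\<^esub> k \<otimes>\<^bsub>H\<^esub> (x [^]\<^bsub>H\<^esub> int m) [^]\<^bsub>H\<^esub> (- q), z * z0 [^]\<^bsub>circle_group\<^esub> (- q)) \<in> \<Gamma>"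
        by (rule c(3)[OF z c(4)[OF z0]])
      moreover have "x [^]\<^bsub>H\<^esub> k \<otimes>\<^bsub>H\<^esub> (x [^]\<^bsub>H\<^esub> int m) [^]\<^bsub>H\<^esub> (- q) = x [^]\<^bsub>H\<^esub> r"
        using x k(1) by (simp add: H.int_pow_pow H.int_pow_mult[symmetric])
      ultimately have "J r" by (auto simp: J_def)
      then have "r = 0" using min[of "nat r"] k by (cases "r = 0") (auto simp: nat_less_iff)
      then have "(x [^]\<^bsub>H\<^esub> k, z0 [^]\<^bsub>circle_group\<^esub> q) \<in> \<Gamma>"
        using c(4)[OF z0, of q] x k(1) by (simp add: H.int_pow_pow)
      then have "z = z0 [^]\<^bsub>circle_group\<^esub> q" by (rule partial_character_unique[OF \<Gamma> z])
      also have "\<dots> = w [^]\<^bsub>circle_group\<^esub> (int m * q)"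
        unfolding wm[symmetric] using w(1) by (intro circle.int_pow_pow) simp
      also have "int m * q = k" using k(1) \<open>r = 0\<close> by simp
      finally show ?thesis .
    qed
    moreover have "w \<noteq> 1" if "\<And>z. (x, z) \<notin> \<Gamma>"
    proof -
      have "m \<noteq> 1" using z0 that x by (auto simp: int_pow_int)
      then show ?thesis using w(3) m(1) by simp
    qed
    ultimately show thesis by (rule that[OF w(1)])
  qed
qed

text \<open>The graph of the extension is generated by \<open>\<Gamma>\<close> and \<open>(x, w)\<close>; compatibility with the powers of
  \<open>x\<close> that already have a value says that it is single-valued.\<close>

lemma partial_character_extension:
  assumes \<Gamma>: "partial_character H \<Gamma>" and x: "x \<in> carrier H" and w: "cmod w = 1"
    and compat: "\<And>(k :: int) z. (x [^]\<^bsub>H\<^esub> k, z) \<in> \<Gamma> \<Longrightarrow> z = w [^]\<^bsub>circle_group\<^esub> k"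
  obtains \<Gamma>' where "partial_character H \<Gamma>'" "\<Gamma> \<subseteq> \<Gamma>'" "(x, w) \<in> \<Gamma>'"
proof -
  note c = partial_character_closed[OF \<Gamma>]
  define e where "e k p = (x [^]\<^bsub>H\<^esub> k \<otimes>\<^bsub>H\<^esub> fst p, w [^]\<^bsub>circle_group\<^esub> k * snd p)" for k :: int and p
  define \<Gamma>' where "\<Gamma>' = {e k p | k p. p \<in> \<Gamma>}"
  have wk: "cmod (w [^]\<^bsub>circle_group\<^esub> (k :: int)) = 1" for k using circle.int_pow_closed[of w k] w by simp
  have e: "e k (a, z) \<otimes>\<^bsub>H \<times>\<times> circle_group\<^esub> e l (b, y) = e (k + l) (a \<otimes>\<^bsub>H\<^esub> b, z * y)"
    if "a \<in> carrier H" "b \<in> carrier H" for k l a b z y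
    using that x w
    by (auto simp: e_def H.int_pow_mult circle.int_pow_mult H.m_ac)
  have "subgroup \<Gamma>' (H \<times>\<times> circle_group)"
  proof (rule D.subgroupI)
    show "\<Gamma>' \<subseteq> carrier (H \<times>\<times> circle_group)"
      using c(1) x wk by (auto simp: \<Gamma>'_def e_def norm_mult)
    show "\<Gamma>' \<noteq> {}" unfolding \<Gamma>'_def using c(2) by blast
  next
    fix p assume "p \<in> \<Gamma>'"
    then obtain k a z where p: "p = e k (a, z)" and az: "(a, z) \<in> \<Gamma>" by (auto simp: \<Gamma>'_def)
    define q where "q = e (- k) (a [^]\<^bsub>H\<^esub> (-1 :: int), z [^]\<^bsub>circle_group\<^esub> (-1 :: int))"
    note cz = c(1)[OF az] and ci = c(1)[OF c(4)[OF az, of "-1"]]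
    have "z [^]\<^bsub>circle_group\<^esub> (-1 :: int) * z [^]\<^bsub>circle_group\<^esub> (1 :: int) = 1"
      using cz circle.int_pow_mult[of z "-1" 1] by simp
    moreover have "z [^]\<^bsub>circle_group\<^esub> (1 :: int) = z" using cz circle.int_pow_1[of z] by simp
    ultimately have zi: "z [^]\<^bsub>circle_group\<^esub> (-1 :: int) * z = 1" by simp
    have "q \<otimes>\<^bsub>H \<times>\<times> circle_group\<^esub> p = \<one>\<^bsub>H \<times>\<times> circle_group\<^esub>"
      unfolding p q_def using cz ci zi by (subst e) (auto simp: e_def H.int_pow_neg)
    moreover have "q \<in> \<Gamma>'" using c(4)[OF az] by (auto simp: \<Gamma>'_def q_def)
    moreover have "p \<in> carrier (H \<times>\<times> circle_group)" "q \<in> carrier (H \<times>\<times> circle_group)"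
      using cz ci x wk by (auto simp: p q_def e_def norm_mult)
    ultimately show "inv\<^bsub>H \<times>\<times> circle_group\<^esub> p \<in> \<Gamma>'" using D.inv_equality by metis
  next
    fix p q assume "p \<in> \<Gamma>'" "q \<in> \<Gamma>'"
    then obtain k a z l b y where "p = e k (a, z)" "(a, z) \<in> \<Gamma>" "q = e l (b, y)" "(b, y) \<in> \<Gamma>"
      by (auto simp: \<Gamma>'_def)
    moreover from this have "p \<otimes>\<^bsub>H \<times>\<times> circle_group\<^esub> q = e (k + l) (a \<otimes>\<^bsub>H\<^esub> b, z * y)"
      using c(1) by (simp only: e)
    ultimately show "p \<otimes>\<^bsub>H \<times>\<times> circle_group\<^esub> q \<in> \<Gamma>'" using c(3) unfolding \<Gamma>'_def by blast
  qed
  moreover have "y = 1" if one: "(\<one>\<^bsub>H\<^esub>, y) \<in> \<Gamma>'" for y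
  proof -
    obtain k :: int and a z where az: "(a, z) \<in> \<Gamma>" and k: "x [^]\<^bsub>H\<^esub> k \<otimes>\<^bsub>H\<^esub> a = \<one>\<^bsub>H\<^esub>" "y = w [^]\<^bsub>circle_group\<^esub> k * z"
    proof -
      obtain k p where "(\<one>\<^bsub>H\<^esub>, y) = e k p" "p \<in> \<Gamma>" using one unfolding \<Gamma>'_def by blast
      then show thesis using that[of "fst p" "snd p" k] by (simp add: e_def)
    qed
    have "a = x [^]\<^bsub>H\<^esub> (- k)"
    proof -
      have "inv\<^bsub>H\<^esub> (x [^]\<^bsub>H\<^esub> k) = a"
        using k(1) x c(1)[OF az] H.m_comm[of a "x [^]\<^bsub>H\<^esub> k"] by (intro H.inv_equality) auto
      then show ?thesis using x by (simp add: H.int_pow_neg)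
    qed
    then have "z = w [^]\<^bsub>circle_group\<^esub> (- k)" using az by (intro compat) simp
    then show ?thesis using k(2) circle.int_pow_mult[of w k "- k"] w by simp
  qed
  ultimately have "partial_character H \<Gamma>'" by (simp add: partial_character_def)
  moreover have "\<Gamma> \<subseteq> \<Gamma>'"
  proof
    fix p assume p: "p \<in> \<Gamma>"
    then have "p = e 0 p" using c(1)[of "fst p" "snd p"] by (auto simp: e_def prod_eq_iff)
    then show "p \<in> \<Gamma>'" unfolding \<Gamma>'_def using p by blast
  qed
  moreover have "(x, w) = e 1 (\<one>\<^bsub>H\<^esub>, 1)" using x w circle.int_pow_1[of w] by (simp add: e_def H.int_pow_1)
  then have "(x, w) \<in> \<Gamma>'" unfolding \<Gamma>'_def using c(2) by blast
  ultimately show thesis by (rule that)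
qed

text \<open>A maximal partial character is defined everywhere. Extending the trivial one to \<open>h\<close> with
  a value other than \<open>1\<close> before applying Zorn's lemma ensures that the result is nontrivial at \<open>h\<close>.\<close>

lemma character_not_one_exists:
  assumes h: "h \<in> carrier H" "h \<noteq> \<one>\<^bsub>H\<^esub>"
  obtains \<chi> where "\<chi> \<in> hom H circle_group" "\<chi> h \<noteq> 1"
proof -
  let ?triv = "{(\<one>\<^bsub>H\<^esub>, 1 :: complex)}"
  have triv: "partial_character H ?triv"
    using D.triv_subgroup by (simp add: partial_character_def)
  obtain w0 where w0: "cmod w0 = 1"
    "\<And>(k :: int) z. (h [^]\<^bsub>H\<^esub> k, z) \<in> ?triv \<Longrightarrow> z = w0 [^]\<^bsub>circle_group\<^esub> k"
    and ne: "(\<And>z. (h, z) \<notin> ?triv) \<Longrightarrow> w0 \<noteq> 1"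
    by (rule partial_character_value_exists[OF triv h(1)]) blast
  have "w0 \<noteq> 1" by (rule ne) (use h(2) in auto)
  obtain \<Gamma>0 where \<Gamma>0: "partial_character H \<Gamma>0" "(h, w0) \<in> \<Gamma>0"
    using partial_character_extension[OF triv h(1) w0] by blast
  define A where "A = {\<Gamma>. partial_character H \<Gamma> \<and> (h, w0) \<in> \<Gamma>}"
  have "\<exists>M\<in>A. \<forall>X\<in>A. M \<subseteq> X \<longrightarrow> X = M"
  proof (rule subset_Zorn_nonempty)
    show "A \<noteq> {}" using \<Gamma>0 by (auto simp: A_def)
    fix C assume C: "C \<noteq> {}" "subset.chain A C"
    then have CA: "\<And>X. X \<in> C \<Longrightarrow> partial_character H X \<and> (h, w0) \<in> X"
      and tot: "\<And>X Y. X \<in> C \<Longrightarrow> Y \<in> C \<Longrightarrow> X \<subseteq> Y \<or> Y \<subseteq> X"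
      by (auto simp: subset_chain_def A_def)
    have sub: "\<And>X. X \<in> C \<Longrightarrow> subgroup X (H \<times>\<times> circle_group)" using CA by (auto simp: partial_character_def)
    have "subgroup (\<Union>C) (H \<times>\<times> circle_group)"
    proof (rule D.subgroupI)
      show "\<Union>C \<subseteq> carrier (H \<times>\<times> circle_group)" using subgroup.subset[OF sub] by blast
      show "\<Union>C \<noteq> {}" using C(1) CA by blast
      show "inv\<^bsub>H \<times>\<times> circle_group\<^esub> p \<in> \<Union>C" if "p \<in> \<Union>C" for p
        using that subgroup.m_inv_closed[OF sub] by blast
      show "p \<otimes>\<^bsub>H \<times>\<times> circle_group\<^esub> q \<in> \<Union>C" if "p \<in> \<Union>C" "q \<in> \<Union>C" for p q
      proof -
        obtain X Y where XY: "p \<in> X" "X \<in> C" "q \<in> Y" "Y \<in> C" using \<open>p \<in> \<Union>C\<close> \<open>q \<in> \<Union>C\<close> by blast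
        then obtain Z where "Z \<in> C" "p \<in> Z" "q \<in> Z" using tot[OF XY(2,4)] by blast
        then show ?thesis using subgroup.m_closed[OF sub] by blast
      qed
    qed
    then show "\<Union>C \<in> A" using C(1) CA by (auto simp: A_def partial_character_def)
  qed
  then obtain M where M: "partial_character H M" "(h, w0) \<in> M"
    and max: "\<And>X. \<lbrakk>partial_character H X; M \<subseteq> X\<rbrakk> \<Longrightarrow> X = M" unfolding A_def by blast
  have total: "\<exists>z. (x, z) \<in> M" if x: "x \<in> carrier H" for x
  proof -
    obtain w where w: "cmod w = 1"
      "\<And>(k :: int) z. (x [^]\<^bsub>H\<^esub> k, z) \<in> M \<Longrightarrow> z = w [^]\<^bsub>circle_group\<^esub> k"
      by (rule partial_character_value_exists[OF M(1) x]) blast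
    obtain M' where "partial_character H M'" "M \<subseteq> M'" "(x, w) \<in> M'"
      using partial_character_extension[OF M(1) x w] .
    with max show ?thesis by blast
  qed
  define \<chi> where "\<chi> a = (THE z. (a, z) \<in> M)" for a
  have eq: "\<chi> a = z" if "(a, z) \<in> M" for a z
    unfolding \<chi>_def using that partial_character_unique[OF M(1)] by blast
  have in_M: "(a, \<chi> a) \<in> M" if "a \<in> carrier H" for a using total[OF that] eq by auto
  note c = partial_character_closed[OF M(1)]
  have "\<chi> \<in> hom H circle_group"
    using c(1)[OF in_M] eq[OF c(3)[OF in_M in_M]] by (auto simp: hom_def)
  moreover have "\<chi> h \<noteq> 1" using eq[OF M(2)] \<open>w0 \<noteq> 1\<close> by simp
  ultimately show thesis by (rule that)
qed

lemma characters_separate_points: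
  assumes x: "x \<in> carrier H" and y: "y \<in> carrier H" and "x \<noteq> y"
  obtains \<chi> where "\<chi> \<in> hom H circle_group" "\<chi> x \<noteq> \<chi> y"
proof -
  have "x \<otimes>\<^bsub>H\<^esub> inv\<^bsub>H\<^esub> y \<noteq> \<one>\<^bsub>H\<^esub>" using assms by (metis H.inv_equality H.inv_inv H.inv_closed)
  then obtain \<chi> where \<chi>: "\<chi> \<in> hom H circle_group" "\<chi> (x \<otimes>\<^bsub>H\<^esub> inv\<^bsub>H\<^esub> y) \<noteq> 1"
    using character_not_one_exists[of "x \<otimes>\<^bsub>H\<^esub> inv\<^bsub>H\<^esub> y"] x y by auto
  have m: "\<chi> (a \<otimes>\<^bsub>H\<^esub> b) = \<chi> a * \<chi> b" if "a \<in> carrier H" "b \<in> carrier H" for a b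
    using \<chi>(1) that by (auto simp: hom_def)
  have "\<chi> y * \<chi> (inv\<^bsub>H\<^esub> y) = \<chi> \<one>\<^bsub>H\<^esub>" using y by (simp flip: m)
  moreover have "\<chi> \<one>\<^bsub>H\<^esub> = 1" using hom_one[OF \<chi>(1) H.is_group circle.is_group] by simp
  ultimately have "\<chi> x \<noteq> \<chi> y" using \<chi>(2) x y by (auto simp: m)
  with \<chi>(1) show thesis by (rule that)
qed

end

section \<open>Separation by finite quotients and injective homomorphisms\<close>

text \<open>Take the product of finitely many finite quotients, one for each point to be separated from
  \<open>k0\<close>.\<close>

lemma residually_finite_separates_from_finite_set:
  fixes G :: "('g, 'k) monoid_scheme"
  assumes rf: "residually_finite G" and G: "group G"
    and S: "finite S" "S \<subseteq> carrier G" and k0: "k0 \<in> carrier G"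
  obtains F :: "('g \<Rightarrow> nat) monoid" and \<phi> where "group F" "finite (carrier F)" "\<phi> \<in> hom G F"
    "\<And>k. \<lbrakk>k \<in> S; k \<noteq> k0\<rbrakk> \<Longrightarrow> \<phi> k \<noteq> \<phi> k0"
proof -
  have "\<exists>(K :: nat monoid) \<psi>. k \<in> S - {k0} \<longrightarrow>
      group K \<and> finite (carrier K) \<and> \<psi> \<in> hom G K \<and> \<psi> k \<noteq> \<psi> k0" for k
    using rf k0 S(2) unfolding residually_finite_def by blast
  then obtain K :: "'g \<Rightarrow> nat monoid" and \<psi> where K: "\<And>k. k \<in> S - {k0} \<Longrightarrow>
      group (K k) \<and> finite (carrier (K k)) \<and> \<psi> k \<in> hom G (K k) \<and> \<psi> k k \<noteq> \<psi> k k0"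
    by metis
  define F where "F = product_group (S - {k0}) K"
  define \<phi> where "\<phi> x = (\<lambda>k\<in>S - {k0}. \<psi> k x)" for x
  have "group F" unfolding F_def by (rule product_group) (use K in blast)
  moreover have "finite (carrier F)" unfolding F_def carrier_product_group
    using S(1) K by (intro finite_PiE) auto
  moreover have "\<phi> \<in> hom G F"
    using K by (auto simp: hom_def F_def \<phi>_def Pi_iff fun_eq_iff intro!: restrict_ext)
  moreover have "\<phi> k \<noteq> \<phi> k0" if "k \<in> S" "k \<noteq> k0" for k
    using K[of k] that by (auto simp: \<phi>_def fun_eq_iff)
  ultimately show thesis by (rule that)
qed

lemma maximally_almost_periodic_injective_hom:
  assumes f: "f \<in> hom K L" "inj_on f (carrier K)" and L: "maximally_almost_periodic L"
  shows "maximally_almost_periodic K"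
  unfolding maximally_almost_periodic_def
proof (intro ballI impI)
  fix x y assume xy: "x \<in> carrier K" "y \<in> carrier K" "x \<noteq> y"
  then have "f x \<in> carrier L" "f y \<in> carrier L" "f x \<noteq> f y"
    using f by (auto simp: hom_def inj_on_def)
  then obtain n \<rho> where \<rho>: "\<rho> \<in> hom L (unitary_group n)" "\<rho> (f x) \<noteq> \<rho> (f y)"
    using L unfolding maximally_almost_periodic_def by blast
  then show "\<exists>n. \<exists>\<rho>\<in>hom K (unitary_group n). \<rho> x \<noteq> \<rho> y"
    using hom_compose[OF f(1) \<rho>(1)] by (intro exI[of _ n] bexI[of _ "\<rho> \<circ> f"]) auto
qed

section \<open>Elements of the wreath product\<close>

locale wreath_groups = H: group H + G: group G
  for H :: "('h, 'm) monoid_scheme" and G :: "('g, 'k) monoid_scheme"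
begin

abbreviation N :: "('g \<Rightarrow> 'h) monoid" where "N \<equiv> sum_group (carrier G) (\<lambda>_. H)"

abbreviation W :: "(('g \<Rightarrow> 'h) \<times> 'g) monoid" where "W \<equiv> wreath_product H G"

sublocale W: group W
  by (rule group_wreath_product[OF H.is_group G.is_group])

sublocale N: group N
  by (rule sum_group) (rule H.is_group)

lemma carrier_N: "carrier N = {f \<in> carrier G \<rightarrow>\<^sub>E carrier H. finite {k \<in> carrier G. f k \<noteq> \<one>\<^bsub>H\<^esub>}}"
  by (rule carrier_sum_group) (rule H.is_group)

lemma carrier_W: "carrier W = carrier N \<times> carrier G"
  by (simp add: wreath_product_def)

lemma mult_W: "(a, g) \<otimes>\<^bsub>W\<^esub> (b, h) = (a \<otimes>\<^bsub>N\<^esub> shift_action G g b, g \<otimes>\<^bsub>G\<^esub> h)"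
  by (simp add: wreath_product_def)

lemma shift_action_closed:
  assumes g: "g \<in> carrier G" and f: "f \<in> carrier N"
  shows "shift_action G g f \<in> carrier N"
proof -
  have "(\<one>\<^bsub>N\<^esub>, g) \<otimes>\<^bsub>W\<^esub> (f, \<one>\<^bsub>G\<^esub>) \<in> carrier W"
    using g f N.one_closed by (intro W.m_closed) (auto simp: carrier_W)
  then have "\<one>\<^bsub>N\<^esub> \<otimes>\<^bsub>N\<^esub> shift_action G g f \<in> carrier N" by (simp add: mult_W carrier_W del: mult_sum_group one_sum_group)
  moreover have "\<one>\<^bsub>N\<^esub> \<otimes>\<^bsub>N\<^esub> shift_action G g f = shift_action G g f"
    using g f by (auto simp: shift_action_def fun_eq_iff carrier_N PiE_iff)
  ultimately show ?thesis by simp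
qed

definition delta :: "'g \<Rightarrow> 'h \<Rightarrow> 'g \<Rightarrow> 'h"
  where "delta g h = (\<lambda>k \<in> carrier G. if k = g then h else \<one>\<^bsub>H\<^esub>)"

lemma delta_closed: "h \<in> carrier H \<Longrightarrow> delta g h \<in> carrier N"
  by (auto simp: carrier_N delta_def intro!: finite_subset[of _ "{g}"])

lemma delta_eq_iff:
  assumes "g \<in> carrier G" "k \<in> carrier G" "h \<noteq> \<one>\<^bsub>H\<^esub>"
  shows "delta g h = delta k h \<longleftrightarrow> g = k"
  using assms by (auto simp: delta_def fun_eq_iff restrict_def)

lemma delta_value_eq_iff: "g \<in> carrier G \<Longrightarrow> delta g h = delta g h' \<longleftrightarrow> h = h'"
  by (auto simp: delta_def fun_eq_iff restrict_def)

lemma delta_mult: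
  assumes "h \<in> carrier H" "h' \<in> carrier H"
  shows "delta g h \<otimes>\<^bsub>N\<^esub> delta g h' = delta g (h \<otimes>\<^bsub>H\<^esub> h')"
  using assms by (auto simp: delta_def fun_eq_iff)

lemma delta_commute:
  assumes "h \<in> carrier H" "h' \<in> carrier H" "g \<noteq> g'"
  shows "delta g h \<otimes>\<^bsub>N\<^esub> delta g' h' = delta g' h' \<otimes>\<^bsub>N\<^esub> delta g h"
  using assms by (auto simp: delta_def fun_eq_iff)

lemma shift_action_delta:
  assumes "g \<in> carrier G" "k \<in> carrier G"
  shows "shift_action G g (delta k h) = delta (g \<otimes>\<^bsub>G\<^esub> k) h"
  using assms by (auto simp: delta_def shift_action_def fun_eq_iff G.inv_solve_left')

lemma shift_action_one: "f \<in> carrier N \<Longrightarrow> shift_action G \<one>\<^bsub>G\<^esub> f = f"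
  by (auto simp: shift_action_def fun_eq_iff carrier_N PiE_iff extensional_def)

lemma shift_action_one_right: "g \<in> carrier G \<Longrightarrow> shift_action G g \<one>\<^bsub>N\<^esub> = \<one>\<^bsub>N\<^esub>"
  by (auto simp: shift_action_def fun_eq_iff)

lemma base_mult_W:
  assumes "f \<in> carrier N" "f' \<in> carrier N"
  shows "(f, \<one>\<^bsub>G\<^esub>) \<otimes>\<^bsub>W\<^esub> (f', \<one>\<^bsub>G\<^esub>) = (f \<otimes>\<^bsub>N\<^esub> f', \<one>\<^bsub>G\<^esub>)"
  using assms by (simp add: mult_W shift_action_one del: mult_sum_group)

lemma top_embedding: "(\<lambda>g. (\<one>\<^bsub>N\<^esub>, g)) \<in> hom G W"
  by (rule homI) (auto simp del: mult_sum_group one_sum_group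
      simp: mult_W carrier_W shift_action_one_right)

lemma coordinate_embedding: "g \<in> carrier G \<Longrightarrow> (\<lambda>h. (delta g h, \<one>\<^bsub>G\<^esub>)) \<in> hom H W"
  by (rule homI) (auto simp del: mult_sum_group
      simp: base_mult_W carrier_W delta_mult delta_closed)

lemma maximally_almost_periodic_factors:
  assumes "maximally_almost_periodic W"
  shows "maximally_almost_periodic H" "maximally_almost_periodic G"
proof -
  show "maximally_almost_periodic H"
    by (rule maximally_almost_periodic_injective_hom[OF coordinate_embedding[OF G.one_closed] _ assms])
      (auto simp: inj_on_def delta_value_eq_iff)
  show "maximally_almost_periodic G"
    by (rule maximally_almost_periodic_injective_hom[OF top_embedding _ assms]) (auto simp: inj_on_def)
qed

section \<open>Unitary representations of a wreath product\<close>

text \<open>For a unitary representation \<open>\<rho>\<close> of the wreath product, \<open>T g\<close> is the image of \<open>g\<close> and \<open>D h g\<close> is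
  the image of the family with entry \<open>h\<close> at \<open>g\<close> and trivial entries elsewhere. Conjugation by \<open>T g\<close>
  moves the coordinate from \<open>k\<close> to \<open>g k\<close>, and images of families at different coordinates
  commute.\<close>

context
  fixes \<rho> :: "('g \<Rightarrow> 'h) \<times> 'g \<Rightarrow> complex mat" and n :: nat
  assumes \<rho>: "\<rho> \<in> hom W (unitary_group n)"
begin

interpretation U: group "unitary_group n" by (rule group_unitary_group)

definition T :: "'g \<Rightarrow> complex mat" where "T g = \<rho> (\<one>\<^bsub>N\<^esub>, g)"

definition D :: "'h \<Rightarrow> 'g \<Rightarrow> complex mat" where "D h g = \<rho> (delta g h, \<one>\<^bsub>G\<^esub>)"

lemma \<rho>_closed: "x \<in> carrier W \<Longrightarrow> \<rho> x \<in> carrier (unitary_group n)"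
  using \<rho> by (auto simp: hom_def)

lemma \<rho>_mult: "\<lbrakk>x \<in> carrier W; y \<in> carrier W\<rbrakk> \<Longrightarrow> \<rho> (x \<otimes>\<^bsub>W\<^esub> y) = \<rho> x \<otimes>\<^bsub>unitary_group n\<^esub> \<rho> y"
  using \<rho> by (auto simp: hom_def)

lemma T_closed: "g \<in> carrier G \<Longrightarrow> T g \<in> carrier (unitary_group n)"
  unfolding T_def using N.one_closed by (intro \<rho>_closed) (simp add: carrier_W)

lemma D_closed: "h \<in> carrier H \<Longrightarrow> D h g \<in> carrier (unitary_group n)"
  unfolding D_def by (intro \<rho>_closed) (simp add: carrier_W delta_closed)

lemma D_conj:
  assumes g: "g \<in> carrier G" and k: "k \<in> carrier G" and h: "h \<in> carrier H"
  shows "D h (g \<otimes>\<^bsub>G\<^esub> k) = T g \<otimes>\<^bsub>unitary_group n\<^esub> D h k \<otimes>\<^bsub>unitary_group n\<^esub> inv\<^bsub>unitary_group n\<^esub> T g"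
proof -
  have W: "(\<one>\<^bsub>N\<^esub>, g) \<in> carrier W" "(delta k h, \<one>\<^bsub>G\<^esub>) \<in> carrier W" "(delta (g \<otimes>\<^bsub>G\<^esub> k) h, \<one>\<^bsub>G\<^esub>) \<in> carrier W"
    using g h delta_closed N.one_closed by (auto simp: carrier_W)
  have "(\<one>\<^bsub>N\<^esub>, g) \<otimes>\<^bsub>W\<^esub> (delta k h, \<one>\<^bsub>G\<^esub>) = (delta (g \<otimes>\<^bsub>G\<^esub> k) h, \<one>\<^bsub>G\<^esub>) \<otimes>\<^bsub>W\<^esub> (\<one>\<^bsub>N\<^esub>, g)"
    using g k h delta_closed N.one_closed
    by (simp del: mult_sum_group one_sum_group add: mult_W shift_action_delta shift_action_one)
  then have "T g \<otimes>\<^bsub>unitary_group n\<^esub> D h k = D h (g \<otimes>\<^bsub>G\<^esub> k) \<otimes>\<^bsub>unitary_group n\<^esub> T g"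
    unfolding T_def D_def by (metis W \<rho>_mult)
  then show ?thesis
    using U.inv_solve_right[OF D_closed[OF h, of "g \<otimes>\<^bsub>G\<^esub> k"] U.m_closed[OF T_closed[OF g] D_closed[OF h, of k]] T_closed[OF g]]
    by simp
qed

lemma D_commute_distinct:
  assumes "h \<in> carrier H" "h' \<in> carrier H" "g \<noteq> g'"
  shows "D h g * D h' g' = D h' g' * D h g"
proof -
  have W: "(delta g h, \<one>\<^bsub>G\<^esub>) \<in> carrier W" "(delta g' h', \<one>\<^bsub>G\<^esub>) \<in> carrier W"
    using assms delta_closed by (auto simp: carrier_W)
  have "(delta g h, \<one>\<^bsub>G\<^esub>) \<otimes>\<^bsub>W\<^esub> (delta g' h', \<one>\<^bsub>G\<^esub>) = (delta g' h', \<one>\<^bsub>G\<^esub>) \<otimes>\<^bsub>W\<^esub> (delta g h, \<one>\<^bsub>G\<^esub>)"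
    using assms delta_commute[OF assms] by (simp del: mult_sum_group add: base_mult_W delta_closed)
  then show ?thesis unfolding D_def using W \<rho>_mult by (metis mult_unitary_group)
qed

lemma D_mult:
  assumes "h \<in> carrier H" "h' \<in> carrier H" "g \<in> carrier G"
  shows "D (h \<otimes>\<^bsub>H\<^esub> h') g = D h g * D h' g"
  using hom_mult[OF hom_compose[OF coordinate_embedding[OF assms(3)] \<rho>] assms(1,2)] by (simp add: D_def)

text \<open>The matrices \<open>D h g\<close> commute and are conjugate, hence have the same finite spectrum.\<close>

lemma finite_coordinate_orbit:
  assumes h: "h \<in> carrier H"
  shows "finite (D h ` carrier G)"
proof (rule commuting_unitaries_finite)
  let ?p = "char_poly (D h \<one>\<^bsub>G\<^esub>)"
  note D1 = unitary_groupD(1)[OF D_closed[OF h, of "\<one>\<^bsub>G\<^esub>"]]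
  show "D h ` carrier G \<subseteq> carrier (unitary_group n)" using D_closed[OF h] by blast
  show "A * B = B * A" if AB: "A \<in> D h ` carrier G" "B \<in> D h ` carrier G" for A B
  proof -
    obtain g g' where "A = D h g" "B = D h g'" using AB by blast
    then show ?thesis using D_commute_distinct[OF h h, of g g'] by (cases "g = g'") auto
  qed
  have "?p \<noteq> 0" using degree_monic_char_poly[OF D1] by auto
  then show "finite {\<alpha>. poly ?p \<alpha> = 0}" by (rule poly_roots_finite)
  show "\<alpha> \<in> {\<alpha>. poly ?p \<alpha> = 0}" if A: "A \<in> D h ` carrier G" "eigenvalue A \<alpha>" for A \<alpha>
  proof -
    obtain g where g: "g \<in> carrier G" "A = D h g" using A by blast
    note Tg = T_closed[OF g(1)]
    have Ti: "inv\<^bsub>unitary_group n\<^esub> T g \<in> carrier (unitary_group n)" using Tg by simp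
    have "A = T g * D h \<one>\<^bsub>G\<^esub> * inv\<^bsub>unitary_group n\<^esub> T g" using D_conj[OF g(1) G.one_closed h] g by simp
    moreover have "T g * inv\<^bsub>unitary_group n\<^esub> T g = 1\<^sub>m n" "inv\<^bsub>unitary_group n\<^esub> T g * T g = 1\<^sub>m n"
      using U.r_inv[OF Tg] U.l_inv[OF Tg] by auto
    ultimately have "similar_mat_wit A (D h \<one>\<^bsub>G\<^esub>) (T g) (inv\<^bsub>unitary_group n\<^esub> T g)"
      using unitary_groupD(1)[OF D_closed[OF h, of g]] g(2) D1 unitary_groupD(1)[OF Tg] unitary_groupD(1)[OF Ti]
      by (intro similar_mat_witI[of _ _ n]) auto
    then have "char_poly A = ?p" by (intro char_poly_similar) (auto simp: similar_mat_def)
    then show ?thesis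
      using A(2) eigenvalue_root_char_poly[of A n] unitary_groupD(1)[OF D_closed[OF h, of g]] g(2) by auto
  qed
qed

text \<open>Infinitely many coordinates share finitely many matrices, so \<open>D h g = D h g'\<close> for some distinct
  \<open>g\<close> and \<open>g'\<close>. The right-hand side commutes with every \<open>D k g\<close>, so the left-hand side does.
  Conjugation transports this from \<open>g\<close> to the identity coordinate.\<close>

lemma D_commutator_collapses:
  assumes inf: "infinite (carrier G)" and h: "h \<in> carrier H" and k: "k \<in> carrier H"
  shows "D (h \<otimes>\<^bsub>H\<^esub> k) \<one>\<^bsub>G\<^esub> = D (k \<otimes>\<^bsub>H\<^esub> h) \<one>\<^bsub>G\<^esub>"
proof -
  have "\<not> inj_on (D h) (carrier G)"
    using finite_coordinate_orbit[OF h] inf finite_imageD by blast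
  then obtain g g' where g: "g \<in> carrier G" "g' \<in> carrier G" "g \<noteq> g'" "D h g = D h g'"
    by (auto simp: inj_on_def)
  have "D (h \<otimes>\<^bsub>H\<^esub> k) g = D h g' * D k g" using D_mult[OF h k g(1)] g(4) by simp
  also have "\<dots> = D k g * D h g'" using D_commute_distinct[OF h k] g(3) by simp
  also have "\<dots> = D (k \<otimes>\<^bsub>H\<^esub> h) g" using D_mult[OF k h g(1)] g(4) by simp
  finally have eq: "D (h \<otimes>\<^bsub>H\<^esub> k) g = D (k \<otimes>\<^bsub>H\<^esub> h) g" .
  show ?thesis
    using D_conj[of "inv\<^bsub>G\<^esub> g" g "h \<otimes>\<^bsub>H\<^esub> k"] D_conj[of "inv\<^bsub>G\<^esub> g" g "k \<otimes>\<^bsub>H\<^esub> h"] eq g(1) h k by simp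
qed

text \<open>Conjugation by \<open>T g\<close> permutes the finite set of all \<open>D h k\<close>, through a finite quotient of \<open>G\<close>.\<close>

lemma coordinate_permutation_action:
  assumes h: "h \<in> carrier H"
  defines "S \<equiv> D h ` carrier G"
  obtains \<phi> where "\<phi> \<in> hom G (BijGroup S)" "\<And>g. g \<in> carrier G \<Longrightarrow> \<phi> g (D h \<one>\<^bsub>G\<^esub>) = D h g"
proof -
  define \<phi> where "\<phi> g = (\<lambda>s \<in> S. T g \<otimes>\<^bsub>unitary_group n\<^esub> s \<otimes>\<^bsub>unitary_group n\<^esub> inv\<^bsub>unitary_group n\<^esub> T g)" for g
  have \<phi>: "\<phi> g (D h k) = D h (g \<otimes>\<^bsub>G\<^esub> k)" if "g \<in> carrier G" "k \<in> carrier G" for g k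
    using D_conj[OF that h] that by (simp add: \<phi>_def S_def)
  have bij: "\<phi> g \<in> Bij S" if g: "g \<in> carrier G" for g
  proof -
    have "bij_betw (\<phi> g) S S"
      by (rule bij_betw_byWitness[of _ "\<phi> (inv\<^bsub>G\<^esub> g)"])
        (use g in \<open>auto simp: S_def \<phi> simp flip: G.m_assoc\<close>)
    then show ?thesis by (simp add: Bij_def \<phi>_def)
  qed
  have "\<phi> \<in> hom G (BijGroup S)"
  proof (rule homI)
    show "\<phi> g \<in> carrier (BijGroup S)" if "g \<in> carrier G" for g
      using bij[OF that] by (simp add: BijGroup_def)
    fix g k assume gk: "g \<in> carrier G" "k \<in> carrier G"
    have "\<phi> (g \<otimes>\<^bsub>G\<^esub> k) = compose S (\<phi> g) (\<phi> k)"
    proof (rule extensionalityI[of _ S])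
      show "\<phi> (g \<otimes>\<^bsub>G\<^esub> k) s = compose S (\<phi> g) (\<phi> k) s" if "s \<in> S" for s
        using that gk by (auto simp: S_def compose_def \<phi> G.m_assoc)
    qed (auto simp: \<phi>_def compose_def)
    then show "\<phi> (g \<otimes>\<^bsub>G\<^esub> k) = \<phi> g \<otimes>\<^bsub>BijGroup S\<^esub> \<phi> k"
      using bij gk by (simp add: BijGroup_def)
  qed
  moreover have "\<phi> g (D h \<one>\<^bsub>G\<^esub>) = D h g" if "g \<in> carrier G" for g using \<phi>[OF that G.one_closed] that by simp
  ultimately show thesis by (rule that)
qed

end

section \<open>Necessity\<close>

lemma comm_group_if_infinite_top:
  assumes map: "maximally_almost_periodic W" and inf: "infinite (carrier G)"
  shows "comm_group H"
proof (rule group.group_comm_groupI[OF H.is_group], rule ccontr)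
  fix h k assume hk: "h \<in> carrier H" "k \<in> carrier H" and ne: "h \<otimes>\<^bsub>H\<^esub> k \<noteq> k \<otimes>\<^bsub>H\<^esub> h"
  let ?x = "(delta \<one>\<^bsub>G\<^esub> (h \<otimes>\<^bsub>H\<^esub> k), \<one>\<^bsub>G\<^esub>)" and ?y = "(delta \<one>\<^bsub>G\<^esub> (k \<otimes>\<^bsub>H\<^esub> h), \<one>\<^bsub>G\<^esub>)"
  have "?x \<in> carrier W" "?y \<in> carrier W" "?x \<noteq> ?y"
    using hk ne by (auto simp: carrier_W delta_closed delta_value_eq_iff)
  then obtain n \<rho> where \<rho>: "\<rho> \<in> hom W (unitary_group n)" "\<rho> ?x \<noteq> \<rho> ?y"
    using map unfolding maximally_almost_periodic_def by blast
  from D_commutator_collapses[OF \<rho>(1) inf hk] \<rho>(2) show False by (simp add: D_def[OF \<rho>(1)])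
qed

text \<open>For \<open>x \<noteq> y\<close> some representation separates \<open>D h x\<close> from \<open>D h y\<close>. Then \<open>x\<close> and \<open>y\<close> move
  \<open>D h \<one>\<close> to different places, so they differ in the finite group of permutations of the orbit.\<close>

lemma residually_finite_if_nontrivial_base:
  assumes map: "maximally_almost_periodic W" and h: "h \<in> carrier H" "h \<noteq> \<one>\<^bsub>H\<^esub>"
  shows "residually_finite G"
proof -
  have "\<exists>K :: (complex mat \<Rightarrow> complex mat) monoid. x \<in> carrier G \<longrightarrow> y \<in> carrier G \<longrightarrow> x \<noteq> y \<longrightarrow>
      group K \<and> finite (carrier K) \<and> (\<exists>\<phi>\<in>hom G K. \<phi> x \<noteq> \<phi> y)" for x y
  proof (cases "x \<in> carrier G \<and> y \<in> carrier G \<and> x \<noteq> y")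
    case True
    let ?x = "(delta x h, \<one>\<^bsub>G\<^esub>)" and ?y = "(delta y h, \<one>\<^bsub>G\<^esub>)"
    have "?x \<in> carrier W" "?y \<in> carrier W" "?x \<noteq> ?y"
      using True h delta_eq_iff by (auto simp: carrier_W delta_closed)
    then obtain n \<rho> where \<rho>: "\<rho> \<in> hom W (unitary_group n)" "\<rho> ?x \<noteq> \<rho> ?y"
      using map unfolding maximally_almost_periodic_def by blast
    let ?S = "D \<rho> h ` carrier G"
    obtain \<phi> where \<phi>: "\<phi> \<in> hom G (BijGroup ?S)"
      "\<And>g. g \<in> carrier G \<Longrightarrow> \<phi> g (D \<rho> h \<one>\<^bsub>G\<^esub>) = D \<rho> h g"
      by (rule coordinate_permutation_action[OF \<rho>(1) h(1)]) blast
    have "\<phi> x \<noteq> \<phi> y" using \<phi>(2)[of x] \<phi>(2)[of y] True \<rho>(2) by (auto simp: D_def[OF \<rho>(1)])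
    moreover have "finite (carrier (BijGroup ?S))"
    proof (rule finite_subset)
      show "carrier (BijGroup ?S) \<subseteq> ?S \<rightarrow>\<^sub>E ?S"
        by (auto simp: BijGroup_def Bij_def PiE_def dest: bij_betw_imp_funcset)
      show "finite (?S \<rightarrow>\<^sub>E ?S)" using finite_coordinate_orbit[OF \<rho>(1) h(1)] by (intro finite_PiE) auto
    qed
    ultimately show ?thesis using \<phi>(1) group_BijGroup by blast
  qed auto
  then obtain K :: "'g \<Rightarrow> 'g \<Rightarrow> (complex mat \<Rightarrow> complex mat) monoid" where
    "\<And>x y. \<lbrakk>x \<in> carrier G; y \<in> carrier G; x \<noteq> y\<rbrakk> \<Longrightarrow>
      group (K x y) \<and> finite (carrier (K x y)) \<and> (\<exists>\<phi>\<in>hom G (K x y). \<phi> x \<noteq> \<phi> y)"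
    by metis
  then show ?thesis by (rule residually_finiteI)
qed

section \<open>Sufficiency\<close>

text \<open>A representation \<open>\<sigma>\<close> of \<open>H\<close>, evaluated at the coordinates, is equivariant for the regular action
  of the finite group \<open>G\<close> on itself, so it induces a representation of the wreath product.\<close>

lemma maximally_almost_periodic_if_finite_top:
  assumes map: "maximally_almost_periodic H" and fin: "finite (carrier G)"
  shows "maximally_almost_periodic W"
  unfolding maximally_almost_periodic_def
proof (intro ballI impI)
  fix x y assume "x \<in> carrier W" "y \<in> carrier W" "x \<noteq> y"
  then obtain f g f' g' where x: "x = (f, g)" "f \<in> carrier N" "g \<in> carrier G"
    and y: "y = (f', g')" "f' \<in> carrier N" "g' \<in> carrier G" and ne: "f \<noteq> f' \<or> g \<noteq> g'"
    by (auto simp: carrier_W)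
  have "\<exists>n. \<exists>\<sigma>\<in>hom H (unitary_group n). (g \<noteq> g' \<and> n > 0) \<or> (\<exists>a\<in>carrier G. \<sigma> (f a) \<noteq> \<sigma> (f' a))"
  proof (cases "g = g'")
    case True
    have "\<exists>a\<in>carrier G. f a \<noteq> f' a"
    proof (rule ccontr)
      assume "\<not> ?thesis"
      then have "f = f'" using x(2) y(2)
        by (intro extensionalityI[of _ "carrier G"]) (auto simp: carrier_N PiE_iff)
      with ne True show False by simp
    qed
    then obtain a where "a \<in> carrier G" "f a \<noteq> f' a"
      by blast
    moreover from this have "f a \<in> carrier H" "f' a \<in> carrier H" using x y by (auto simp: carrier_N)
    ultimately show ?thesis using map unfolding maximally_almost_periodic_def by blast
  next
    case False
    \<comment> \<open>Differing components in \<open>G\<close> are visible in the block permutation once the blocks are not empty.\<close>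
    have "(\<lambda>_. 1\<^sub>m 1) \<in> hom H (unitary_group 1)"
      using group.is_monoid[OF group_unitary_group[of 1]] monoid.one_closed[of "unitary_group 1"]
      by (intro homI) auto
    with False show ?thesis by (intro exI[of _ 1]) auto
  qed
  then obtain n \<sigma> where \<sigma>: "\<sigma> \<in> hom H (unitary_group n)"
    and sep: "(g \<noteq> g' \<and> n > 0) \<or> (\<exists>a\<in>carrier G. \<sigma> (f a) \<noteq> \<sigma> (f' a))" by blast
  show "\<exists>n. \<exists>\<rho>\<in>hom W (unitary_group n). \<rho> x \<noteq> \<rho> y"
    unfolding x(1) y(1) wreath_product_def
  proof (rule induced_representation[of G "\<lambda>g. g" _ _ _ "\<lambda>a f. \<sigma> (f a)" n])
    show "(\<lambda>f. \<sigma> (f a)) \<in> hom N (unitary_group n)" if "a \<in> carrier G" for a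
      using \<sigma> that by (auto simp: hom_def carrier_N PiE_iff)
    show "\<sigma> (shift_action G g f (g \<otimes>\<^bsub>G\<^esub> a)) = \<sigma> (f a)"
      if "a \<in> carrier G" "f \<in> carrier N" "g \<in> carrier G" for a f g
      using that by (simp add: shift_action_def flip: G.m_assoc)
  qed (use G.is_group fin x y sep shift_action_closed in \<open>auto simp: hom_def\<close>)
qed

text \<open>Since the circle group is abelian, the values \<open>\<chi> (f k)\<close> of a finitely supported family can be
  multiplied over any set \<open>P\<close> of coordinates, in particular over a fibre of a finite quotient
  of \<open>G\<close>. Replacing the support by a larger finite set does not change the product, which gives
  multiplicativity in \<open>f\<close>.\<close>

lemma fibre_character_hom:
  assumes \<chi>: "\<chi> \<in> hom H circle_group"
  defines "X \<equiv> \<lambda>P f. \<Prod>k\<in>{k \<in> carrier G. f k \<noteq> \<one>\<^bsub>H\<^esub> \<and> P k}. \<chi> (f k)"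
  shows "f \<in> carrier N \<Longrightarrow> cmod (X P f) = 1"
    and "\<lbrakk>f \<in> carrier N; f' \<in> carrier N\<rbrakk> \<Longrightarrow> X P (f \<otimes>\<^bsub>N\<^esub> f') = X P f * X P f'"
    and "\<lbrakk>finite S; S \<subseteq> carrier G; \<And>k. \<lbrakk>k \<in> carrier G; f k \<noteq> \<one>\<^bsub>H\<^esub>\<rbrakk> \<Longrightarrow> k \<in> S\<rbrakk> \<Longrightarrow>
      X P f = (\<Prod>k\<in>{k \<in> S. P k}. \<chi> (f k))"
proof -
  have \<chi>1: "\<chi> \<one>\<^bsub>H\<^esub> = 1" using hom_one[OF \<chi> H.is_group circle.is_group] by simp
  have \<chi>c: "cmod (\<chi> h) = 1" if "h \<in> carrier H" for h using \<chi> that by (auto simp: hom_def)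
  have \<chi>m: "\<chi> (h \<otimes>\<^bsub>H\<^esub> k) = \<chi> h * \<chi> k" if "h \<in> carrier H" "k \<in> carrier H" for h k
    using \<chi> that by (auto simp: hom_def)
  show superset: "X P f = (\<Prod>k\<in>{k \<in> S. P k}. \<chi> (f k))"
    if "finite S" "S \<subseteq> carrier G" "\<And>k. \<lbrakk>k \<in> carrier G; f k \<noteq> \<one>\<^bsub>H\<^esub>\<rbrakk> \<Longrightarrow> k \<in> S" for S f P
    unfolding X_def by (rule prod.mono_neutral_left) (use that \<chi>1 in auto)
  show "cmod (X P f) = 1" if "f \<in> carrier N"
    unfolding X_def prod_norm[symmetric]
    by (rule prod.neutral) (use that \<chi>c in \<open>auto simp: carrier_N\<close>)
  show "X P (f \<otimes>\<^bsub>N\<^esub> f') = X P f * X P f'" if ff': "f \<in> carrier N" "f' \<in> carrier N"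
  proof -
    define S where "S = {k \<in> carrier G. f k \<noteq> \<one>\<^bsub>H\<^esub>} \<union> {k \<in> carrier G. f' k \<noteq> \<one>\<^bsub>H\<^esub>}"
    have S: "finite S" "S \<subseteq> carrier G" using ff' by (auto simp: S_def carrier_N)
    have "X P (f \<otimes>\<^bsub>N\<^esub> f') = (\<Prod>k\<in>{k \<in> S. P k}. \<chi> ((f \<otimes>\<^bsub>N\<^esub> f') k))"
      using S by (intro superset) (auto simp: S_def)
    also have "\<dots> = (\<Prod>k\<in>{k \<in> S. P k}. \<chi> (f k) * \<chi> (f' k))"
      by (rule prod.cong) (use S(2) ff' in \<open>auto simp: carrier_N intro!: \<chi>m\<close>)
    also have "\<dots> = X P f * X P f'"
      using S superset[of S f P] superset[of S f' P] by (auto simp: prod.distrib S_def)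
    finally show ?thesis .
  qed
qed

text \<open>For a finite quotient \<open>\<phi>\<close> of \<open>G\<close> and a character \<open>\<chi>\<close> of \<open>H\<close>, the products of \<open>\<chi>\<close> over the fibres of
  \<open>\<phi>\<close> are equivariant one-dimensional representations of the base, and they induce a representation of
  the wreath product. Elements with different components \<open>g \<noteq> g'\<close> are separated by a quotient that
  separates these. If \<open>f\<close> and \<open>f'\<close> differ at \<open>k0\<close>, choose \<open>\<chi>\<close> with
  \<open>\<chi> (f k0) \<noteq> \<chi> (f' k0)\<close> and \<open>\<phi>\<close> such that \<open>k0\<close> is alone in its fibre among the points of both
  supports; the product over this fibre is then the value at \<open>k0\<close>.\<close>

lemma maximally_almost_periodic_if_residually_finite_top:
  assumes H: "comm_group H" and rf: "residually_finite G"
  shows "maximally_almost_periodic W"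
  unfolding maximally_almost_periodic_def
proof (intro ballI impI)
  fix x y assume "x \<in> carrier W" "y \<in> carrier W" "x \<noteq> y"
  then obtain f g f' g' where x: "x = (f, g)" "f \<in> carrier N" "g \<in> carrier G"
    and y: "y = (f', g')" "f' \<in> carrier N" "g' \<in> carrier G" and ne: "f \<noteq> f' \<or> g \<noteq> g'"
    by (auto simp: carrier_W)
  define X where "X \<chi> P f = (\<Prod>k\<in>{k \<in> carrier G. f k \<noteq> \<one>\<^bsub>H\<^esub> \<and> P k}. \<chi> (f k))"
    for \<chi> :: "'h \<Rightarrow> complex" and P and f :: "'g \<Rightarrow> 'h"
  have "\<exists>(F :: ('g \<Rightarrow> nat) monoid) \<phi> \<chi>. group F \<and> finite (carrier F) \<and> \<phi> \<in> hom G F \<and> \<chi> \<in> hom H circle_group \<and>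
      (\<phi> g \<noteq> \<phi> g' \<or> (\<exists>a\<in>carrier F. X \<chi> (\<lambda>k. \<phi> k = a) f \<noteq> X \<chi> (\<lambda>k. \<phi> k = a) f'))"
  proof (cases "g = g'")
    case False
    obtain F :: "('g \<Rightarrow> nat) monoid" and \<phi> where F: "group F" "finite (carrier F)" "\<phi> \<in> hom G F"
      "\<And>k. \<lbrakk>k \<in> {g}; k \<noteq> g'\<rbrakk> \<Longrightarrow> \<phi> k \<noteq> \<phi> g'"
      by (rule residually_finite_separates_from_finite_set[OF rf G.is_group, of "{g}" g']) (use x y in auto)
    moreover have "(\<lambda>_. 1) \<in> hom H circle_group" by (auto simp: hom_def)
    ultimately show ?thesis using False by blast
  next
    case True
    have "\<exists>k0\<in>carrier G. f k0 \<noteq> f' k0"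
    proof (rule ccontr)
      assume "\<not> ?thesis"
      then have "f = f'" using x(2) y(2)
        by (intro extensionalityI[of _ "carrier G"]) (auto simp: carrier_N PiE_iff)
      with ne True show False by simp
    qed
    then obtain k0 where k0: "k0 \<in> carrier G" "f k0 \<noteq> f' k0"
      by blast
    moreover from this have "f k0 \<in> carrier H" "f' k0 \<in> carrier H" using x y by (auto simp: carrier_N)
    ultimately obtain \<chi> where \<chi>: "\<chi> \<in> hom H circle_group" "\<chi> (f k0) \<noteq> \<chi> (f' k0)"
      using characters_separate_points[OF H] by metis
    define S where "S = {k \<in> carrier G. f k \<noteq> \<one>\<^bsub>H\<^esub>} \<union> {k \<in> carrier G. f' k \<noteq> \<one>\<^bsub>H\<^esub>}"
    have S: "finite S" "S \<subseteq> carrier G" using x y by (auto simp: S_def carrier_N)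
    obtain F :: "('g \<Rightarrow> nat) monoid" and \<phi> where F: "group F" "finite (carrier F)" "\<phi> \<in> hom G F"
      "\<And>k. \<lbrakk>k \<in> S; k \<noteq> k0\<rbrakk> \<Longrightarrow> \<phi> k \<noteq> \<phi> k0"
      by (rule residually_finite_separates_from_finite_set[OF rf G.is_group S k0(1)]) blast
    have "k0 \<in> S" using k0 by (auto simp: S_def)
    then have "{k \<in> S. \<phi> k = \<phi> k0} = {k0}" using F(4) by auto
    then have "X \<chi> (\<lambda>k. \<phi> k = \<phi> k0) f = \<chi> (f k0)" "X \<chi> (\<lambda>k. \<phi> k = \<phi> k0) f' = \<chi> (f' k0)"
      unfolding X_def
      using fibre_character_hom(3)[OF \<chi>(1) S, of f "\<lambda>k. \<phi> k = \<phi> k0"]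
        fibre_character_hom(3)[OF \<chi>(1) S, of f' "\<lambda>k. \<phi> k = \<phi> k0"]
      by (auto simp: S_def)
    moreover have "\<phi> k0 \<in> carrier F" using F(3) k0 by (auto simp: hom_def)
    ultimately show ?thesis using F \<chi> by metis
  qed
  then obtain F :: "('g \<Rightarrow> nat) monoid" and \<phi> \<chi> where F: "group F" "finite (carrier F)"
    and \<phi>: "\<phi> \<in> hom G F" and \<chi>: "\<chi> \<in> hom H circle_group"
    and sep: "\<phi> g \<noteq> \<phi> g' \<or> (\<exists>a\<in>carrier F. X \<chi> (\<lambda>k. \<phi> k = a) f \<noteq> X \<chi> (\<lambda>k. \<phi> k = a) f')"
    by blast
  interpret F: group F by (rule F(1))
  have \<phi>c: "\<phi> k \<in> carrier F" if "k \<in> carrier G" for k using \<phi> that by (auto simp: hom_def)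
  define \<tau> where "\<tau> a f = mat 1 1 (\<lambda>_. X \<chi> (\<lambda>k. \<phi> k = a) f)" for a f
  note X = fibre_character_hom(1,2)[OF \<chi>, folded X_def]
  show "\<exists>n. \<exists>\<rho>\<in>hom W (unitary_group n). \<rho> x \<noteq> \<rho> y"
    unfolding x(1) y(1) wreath_product_def
  proof (rule induced_representation[OF F \<phi>, of _ _ \<tau> 1])
    show "\<tau> a \<in> hom N (unitary_group 1)" if "a \<in> carrier F" for a
    proof (rule homI)
      fix f assume f: "f \<in> carrier N"
      show "\<tau> a f \<in> carrier (unitary_group 1)"
        using X(1)[OF f, of "\<lambda>k. \<phi> k = a"]
        by (intro unitary_groupI) (auto simp: \<tau>_def complex_norm_square[symmetric])
      fix f' assume f': "f' \<in> carrier N"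
      show "\<tau> a (f \<otimes>\<^bsub>N\<^esub> f') = \<tau> a f \<otimes>\<^bsub>unitary_group 1\<^esub> \<tau> a f'"
        unfolding mult_unitary_group \<tau>_def X(2)[OF f f']
        by (rule eq_matI) (auto simp: scalar_prod_def)
    qed
    show "\<tau> (\<phi> g \<otimes>\<^bsub>F\<^esub> a) (shift_action G g f) = \<tau> a f"
      if a: "a \<in> carrier F" and f: "f \<in> carrier N" and g: "g \<in> carrier G" for a f g
    proof -
      have \<phi>m: "\<phi> (u \<otimes>\<^bsub>G\<^esub> k) = \<phi> u \<otimes>\<^bsub>F\<^esub> \<phi> k" if "u \<in> carrier G" "k \<in> carrier G" for u k
        using \<phi> that by (auto simp: hom_def)
      have cancel: "inv\<^bsub>G\<^esub> g \<otimes>\<^bsub>G\<^esub> (g \<otimes>\<^bsub>G\<^esub> k) = k" "g \<otimes>\<^bsub>G\<^esub> (inv\<^bsub>G\<^esub> g \<otimes>\<^bsub>G\<^esub> k) = k" if "k \<in> carrier G" for k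
        using that g by (simp_all flip: G.m_assoc)
      have "X \<chi> (\<lambda>k. \<phi> k = \<phi> g \<otimes>\<^bsub>F\<^esub> a) (shift_action G g f) = X \<chi> (\<lambda>k. \<phi> k = a) f"
        unfolding X_def
      proof (rule prod.reindex_bij_witness[where j = "\<lambda>k. inv\<^bsub>G\<^esub> g \<otimes>\<^bsub>G\<^esub> k" and i = "\<lambda>k. g \<otimes>\<^bsub>G\<^esub> k"])
        fix k assume "k \<in> {k \<in> carrier G. shift_action G g f k \<noteq> \<one>\<^bsub>H\<^esub> \<and> \<phi> k = \<phi> g \<otimes>\<^bsub>F\<^esub> a}"
        then have k: "k \<in> carrier G" "f (inv\<^bsub>G\<^esub> g \<otimes>\<^bsub>G\<^esub> k) \<noteq> \<one>\<^bsub>H\<^esub>" "\<phi> k = \<phi> g \<otimes>\<^bsub>F\<^esub> a"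
          by (auto simp: shift_action_def)
        have "\<phi> g \<otimes>\<^bsub>F\<^esub> \<phi> (inv\<^bsub>G\<^esub> g \<otimes>\<^bsub>G\<^esub> k) = \<phi> g \<otimes>\<^bsub>F\<^esub> a"
          using k g cancel(2)[OF k(1)] by (simp flip: \<phi>m)
        then have "\<phi> (inv\<^bsub>G\<^esub> g \<otimes>\<^bsub>G\<^esub> k) = a" using a g k \<phi>c by simp
        then show "inv\<^bsub>G\<^esub> g \<otimes>\<^bsub>G\<^esub> k \<in> {k \<in> carrier G. f k \<noteq> \<one>\<^bsub>H\<^esub> \<and> \<phi> k = a}" using k g by simp
      qed (use g \<phi>m cancel in \<open>auto simp: shift_action_def\<close>)
      then show ?thesis by (simp add: \<tau>_def)
    qed
    have "\<tau> a f \<noteq> \<tau> a f'" if "X \<chi> (\<lambda>k. \<phi> k = a) f \<noteq> X \<chi> (\<lambda>k. \<phi> k = a) f'" for a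
      using that by (auto simp: \<tau>_def dest!: arg_cong[of _ _ "\<lambda>A. A $$ (0, 0)"])
    then show "(\<phi> g \<noteq> \<phi> g' \<and> (1 :: nat) > 0) \<or> (\<exists>a\<in>carrier F. \<tau> a f \<noteq> \<tau> a f')" using sep by auto
  qed (use x y shift_action_closed in auto)
qed

lemma maximally_almost_periodic_if_trivial_base:
  assumes triv: "trivial_group H" and map: "maximally_almost_periodic G"
  shows "maximally_almost_periodic W"
proof (rule maximally_almost_periodic_injective_hom[OF _ _ map])
  show "snd \<in> hom W G" by (auto simp: hom_def carrier_W mult_W)
  have "f = f'" if "f \<in> carrier N" "f' \<in> carrier N" for f f'
    using that triv by (auto simp: carrier_N trivial_group_def PiE_iff intro!: extensionalityI[of _ "carrier G"])
  then show "inj_on snd (carrier W)" by (auto simp: inj_on_def carrier_W)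
qed

end

section \<open>The characterization\<close>

theorem theorem5p20:
  fixes H :: "('h, 'm) monoid_scheme" and G :: "('g, 'k) monoid_scheme"
  assumes "group H" and "group G"
  shows "maximally_almost_periodic (wreath_product H G) \<longleftrightarrow>
    (maximally_almost_periodic H \<and> finite (carrier G)) \<or>
    (trivial_group H \<and> maximally_almost_periodic G) \<or>
    (comm_group H \<and> residually_finite G)"
proof -
  interpret wreath_groups H G using assms by (rule wreath_groups.intro)
  show ?thesis
  proof
    assume map: "maximally_almost_periodic W"
    show "(maximally_almost_periodic H \<and> finite (carrier G)) \<or>
      (trivial_group H \<and> maximally_almost_periodic G) \<or> (comm_group H \<and> residually_finite G)"
    proof (cases "finite (carrier G) \<or> trivial_group H")
      case True
      then show ?thesis using maximally_almost_periodic_factors[OF map] by blast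
    next
      case False
      then obtain h where "h \<in> carrier H" "h \<noteq> \<one>\<^bsub>H\<^esub>" by (auto simp: H.trivial_group_subset)
      with False show ?thesis
        using comm_group_if_infinite_top[OF map] residually_finite_if_nontrivial_base[OF map] by blast
    qed
  qed (use maximally_almost_periodic_if_finite_top maximally_almost_periodic_if_trivial_base maximally_almost_periodic_if_residually_finite_top in blast)
qed

end
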